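(* Let $1\leq M<\infty$ and let $\Omega\subset\mathbb{C}$ be an $M$-linearly connected domain. There is a constant $0<c<1$ such that if a sense-preserving univalent harmonic mapping $f$ in $\mathbb{D}$ satisfies $f(\mathbb{D})=\Omega$ and its dilatation $\omega$ satisfies $|\omega(z)|\leq c$ for all $z\in\mathbb{D}$, then $\|A_f\|<2$.
   Context: $\mathbb{D}=\{z\in\mathbb{C}:|z|<1\}$. A (complex-valued) harmonic mapping $f$ in $\mathbb{D}$ is written $f=h+\overline{g}$ with $h,g$ analytic in $\mathbb{D}$. It is called sense-preserving if its Jacobian $J_f=|h'|^2-|g'|^2$ is positive throughout $\mathbb{D}$; then $h'\neq0$ in $\mathbb{D}$, and the (second complex) dilatation $\omega=g'/h'$ is analytic with $|\omega|<1$ in $\mathbb{D}$. Univalent means injective. For sense-preserving $f$ define $$P_f=\partial_z\log J_f=\frac{h''}{h'}-\frac{\overline{\omega}\,\omega'}{1-|\omega|^2},\qquad A_f(z)=\frac{1-|z|^2}{2}P_f(z)-\overline{z},\quad z\in\mathbb{D},$$ and the upper order $\|A_f\|=\sup_{z\in\mathbb{D}}|A_f(z)|$. A domain $\Omega\subset\mathbb{C}$ is $M$-linearly connected ($1\leq M<\infty$) if any two points $w_1,w_2\in\Omega$ are joined by a path $\gamma\subset\Omega$ of length $\ell(\gamma)\leq M|w_1-w_2|$. *)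

theory Defs
  imports "HOL-Complex_Analysis.Complex_Analysis"
begin

definition path_length :: "(real \<Rightarrow> 'a::metric_space) \<Rightarrow> ereal" where
  "path_length \<gamma> =
     (SUP (n, t) \<in> {(n, t). mono_on {..n} t \<and> t ` {..n} \<subseteq> {0..1}}.
        ereal (\<Sum>i<n. dist (\<gamma> (t i)) (\<gamma> (t (Suc i)))))"

definition linearly_connected :: "real \<Rightarrow> complex set \<Rightarrow> bool" where
  "linearly_connected M \<Omega> \<longleftrightarrow>
     (\<forall>w1\<in>\<Omega>. \<forall>w2\<in>\<Omega>. \<exists>\<gamma>. path \<gamma> \<and> path_image \<gamma> \<subseteq> \<Omega> \<and>
        pathstart \<gamma> = w1 \<and> pathfinish \<gamma> = w2 \<and>
        path_length \<gamma> \<le> ereal (M * cmod (w1 - w2)))"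

(* A harmonic mapping f = h + cnj g of the unit disc is carried together with its analytic parts
   h and g. These are unique up to additive constants, and the notions below depend only on
   h' and g', hence only on f. *)
definition harmonic_mapping ::
    "(complex \<Rightarrow> complex) \<Rightarrow> (complex \<Rightarrow> complex) \<Rightarrow> (complex \<Rightarrow> complex) \<Rightarrow> bool" where
  "harmonic_mapping f h g \<longleftrightarrow>
     h holomorphic_on ball 0 1 \<and> g holomorphic_on ball 0 1 \<and>
     (\<forall>z\<in>ball 0 1. f z = h z + cnj (g z))"

definition harmonic_jacobian :: "(complex \<Rightarrow> complex) \<Rightarrow> (complex \<Rightarrow> complex) \<Rightarrow> complex \<Rightarrow> real" where
  "harmonic_jacobian h g z = (cmod (deriv h z))\<^sup>2 - (cmod (deriv g z))\<^sup>2"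

definition sense_preserving :: "(complex \<Rightarrow> complex) \<Rightarrow> (complex \<Rightarrow> complex) \<Rightarrow> bool" where
  "sense_preserving h g \<longleftrightarrow> (\<forall>z\<in>ball 0 1. harmonic_jacobian h g z > 0)"

definition dilatation :: "(complex \<Rightarrow> complex) \<Rightarrow> (complex \<Rightarrow> complex) \<Rightarrow> complex \<Rightarrow> complex" where
  "dilatation h g z = deriv g z / deriv h z"

(* The Wirtinger derivative (F_x - i F_y) / 2. *)
definition wirtinger_dz :: "(complex \<Rightarrow> complex) \<Rightarrow> complex \<Rightarrow> complex" where
  "wirtinger_dz F z = (frechet_derivative F (at z) 1 - \<i> * frechet_derivative F (at z) \<i>) / 2"

definition P_op :: "(complex \<Rightarrow> complex) \<Rightarrow> (complex \<Rightarrow> complex) \<Rightarrow> complex \<Rightarrow> complex" where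
  "P_op h g = wirtinger_dz (\<lambda>w. complex_of_real (ln (harmonic_jacobian h g w)))"

definition A_op :: "(complex \<Rightarrow> complex) \<Rightarrow> (complex \<Rightarrow> complex) \<Rightarrow> complex \<Rightarrow> complex" where
  "A_op h g z = complex_of_real ((1 - (cmod z)\<^sup>2) / 2) * P_op h g z - cnj z"

definition upper_order :: "(complex \<Rightarrow> complex) \<Rightarrow> (complex \<Rightarrow> complex) \<Rightarrow> ereal" where
  "upper_order h g = (SUP z\<in>ball 0 1. ereal (cmod (A_op h g z)))"

lemma P_op_eq:
  assumes h: "h holomorphic_on ball 0 1" and g: "g holomorphic_on ball 0 1"
    and sp: "sense_preserving h g" and z: "z \<in> ball 0 1"
  shows "P_op h g z = deriv (deriv h) z / deriv h z
     - cnj (dilatation h g z) * deriv (dilatation h g) z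
         / complex_of_real (1 - (cmod (dilatation h g z))\<^sup>2)"
proof -
  define a b a2 b2 where ab: "a = deriv h z" "b = deriv g z"
    "a2 = deriv (deriv h) z" "b2 = deriv (deriv g) z"
  define J where "J = harmonic_jacobian h g z"
  have J0: "J > 0" using sp z by (auto simp: sense_preserving_def J_def)
  have cns: "(complex_of_real (cmod x))\<^sup>2 = x * cnj x" for x
    using complex_norm_square[of x] by simp
  have Jeq: "complex_of_real J = a * cnj a - b * cnj b"
    by (simp add: J_def harmonic_jacobian_def ab cns)
  have a0: "a \<noteq> 0" using J0 by (auto simp: J_def harmonic_jacobian_def ab)
  have dh: "(deriv h has_field_derivative a2) (at z)"
    unfolding ab by (rule holomorphic_derivI[OF holomorphic_deriv[OF h]]) (use z in auto)
  have dg: "(deriv g has_field_derivative b2) (at z)"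
    unfolding ab by (rule holomorphic_derivI[OF holomorphic_deriv[OF g]]) (use z in auto)
  define L where "L = (\<lambda>v. complex_of_real ((2 * inner a (a2 * v) - 2 * inner b (b2 * v)) / J))"
  have 1: "((\<lambda>w. complex_of_real (ln (harmonic_jacobian h g w))) has_derivative L) (at z)"
  proof -
    note dh' = dh[unfolded has_field_derivative_def] and dg' = dg[unfolded has_field_derivative_def]
    have "(harmonic_jacobian h g has_derivative (\<lambda>v. 2 * inner a (a2 * v) - 2 * inner b (b2 * v))) (at z)"
      unfolding harmonic_jacobian_def power2_norm_eq_inner
      by (rule derivative_eq_intros dh' dg' refl)+ (simp add: ab inner_commute fun_eq_iff)
    from has_derivative_ln[OF _ this] J0
    have "((\<lambda>w. ln (harmonic_jacobian h g w)) has_derivative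
        (\<lambda>v. (2 * inner a (a2 * v) - 2 * inner b (b2 * v)) * inverse J)) (at z)"
      by (simp add: J_def)
    from has_derivative_of_real[OF this, where 'a = complex] show ?thesis
      by (simp add: L_def divide_inverse)
  qed
  have "P_op h g z = (L 1 - \<i> * L \<i>) / 2"
    unfolding P_op_def wirtinger_dz_def by (simp add: frechet_derivative_at[OF 1, symmetric])
  also have "\<dots> = (a2 * cnj a - b2 * cnj b) / J"
    using J0 by (simp add: L_def complex_eq_iff inner_complex_def field_simps)
  finally have P: "P_op h g z = (a2 * cnj a - b2 * cnj b) / J" .
  have "(dilatation h g has_field_derivative (b2 * a - b * a2) / (a * a)) (at z)"
    unfolding dilatation_def using DERIV_divide[OF dg dh] a0 by (simp add: ab)
  then have w: "deriv (dilatation h g) z = (b2 * a - b * a2) / (a * a)"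
    by (rule DERIV_imp_deriv)
  have *: "complex_of_real (1 - (cmod (b / a))\<^sup>2) = J / (a * cnj a)"
    using a0 by (simp add: cns Jeq field_simps)
  have "a2 / a - cnj (b / a) * ((b2 * a - b * a2) / (a * a)) /
      complex_of_real (1 - (cmod (b / a))\<^sup>2) = (a2 * J - cnj b * (b2 * a - b * a2)) / (a * J)"
    unfolding * using a0 J0 by (simp add: divide_simps) (simp add: algebra_simps)?
  also have "\<dots> = (a2 * cnj a - b2 * cnj b) / J"
    using a0 J0 by (simp add: divide_simps) (simp add: Jeq algebra_simps)
  finally show ?thesis
    using P w by (simp add: dilatation_def ab)
qed

end

theory Submission
  imports Defs
begin

text \<open>
  Write \<open>f = h + cnj g\<close>. When the dilatation is bounded by a small \<open>c\<close>, the function \<open>g\<close>, viewed as a function of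
  \<open>w = f z\<close>, is locally Lipschitz with constant at most \<open>2 * c\<close>. A path in \<open>\<Omega>\<close> that joins two points and is at most \<open>M\<close> times as
  long as their distance therefore changes \<open>g\<close> only by a fraction of that distance. It follows
  (\<open>analytic_part_bounded_turning\<close>) that \<open>h = w - cnj g\<close> is itself injective, and that two points of its image can be joined
  inside the image by a path that strays from its start by at most \<open>3 * M\<close> times their distance. This bounded
  turning is the form in which linear connectivity enters the estimate for \<open>h\<close>.

  For the conformal map \<open>h\<close> the analogue of \<open>A_op\<close> at \<open>z\<close> is the second Taylor coefficient \<open>a2\<close> of the Koebe transform \<open>F\<close> of \<open>h\<close> at
  \<open>z\<close>, and \<open>F\<close> inherits injectivity and bounded turning. What is needed is thus Bieberbach's inequality
  \<open>cmod a2 \<le> 2\<close> with a gap that depends on \<open>M\<close> only. Bieberbach's inequality is the area theorem for the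
  function \<open>1 / sqrt (F (z\<^sup>2)) = 1 / z - (a2 / 2) * z + ...\<close>. If this function omits a disc of radius \<open>\<delta>\<close>, the area theorem
  improves to \<open>(cmod a2 / 2)\<^sup>2 + \<delta>\<^sup>2 \<le> 1\<close> (\<open>area_theorem_with_omitted_disc\<close>, \<open>second_coefficient_omitted_disc\<close>), so it suffices to find
  an omitted disc of definite size.

  Let \<open>p\<close> be a value omitted by \<open>F\<close> and let \<open>S\<close> be a branch of \<open>sqrt (1 - F / p)\<close> on the disc. If \<open>S\<close> took two almost
  opposite values, the corresponding values of \<open>F\<close> would be close to each other; but a path in the image between them has to
  go around \<open>p\<close> in order to change the branch of the square root, which contradicts bounded turning. Hence
  \<open>S\<close> keeps away from \<open>- S\<close> by a distance proportional to its modulus (\<open>sqrt_values_not_antipodal\<close>). A point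
  of the unit circle that is equally far from the image of \<open>S\<close> and from its negative is then the centre of a disc
  that misses both (\<open>antipodal_discs_outside\<close>), and the points \<open>p * (1 - v\<^sup>2)\<close> for \<open>v\<close> in this disc are omitted by \<open>F\<close>. Koebe's
  function, whose image is a slit plane, shows what is being excluded: the two sides of the slit are
  close in the plane but far apart inside the image.

  Finally \<open>A_op\<close> for \<open>f\<close> differs from the analogue for \<open>h\<close> by at most \<open>c\<close> (\<open>A_op_close_to_analytic_part\<close>), and \<open>c\<close> can be taken
  smaller than the gap.
\<close>

(* The dollar sign is to denote vector components rather than coefficients of power series. *)
unbundle no fps_syntax

section \<open>Plane areas under holomorphic maps\<close>

text \<open>
  Jacobian determinants belong to maps of \<open>real^2\<close>, so areas of plane sets are computed after the
  isometry \<open>rvec\<close>; \<open>cpx\<close> is its inverse.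
\<close>
definition rvec :: "complex \<Rightarrow> real^2" where
  "rvec z = vector [Re z, Im z]"

definition cpx :: "real^2 \<Rightarrow> complex" where
  "cpx v = Complex (v $ 1) (v $ 2)"

lemma cpx_rvec [simp]: "cpx (rvec z) = z" and rvec_cpx [simp]: "rvec (cpx v) = v"
  by (simp_all add: rvec_def cpx_def vec_eq_iff forall_2)

lemma rvec_nth [simp]: "rvec z $ 1 = Re z" "rvec z $ 2 = Im z"
  by (simp_all add: rvec_def)

lemma linear_rvec: "linear rvec" and linear_cpx: "linear cpx"
  by (auto intro!: linearI simp: vec_eq_iff forall_2 cpx_def complex_eq_iff)

lemma norm_rvec [simp]: "norm (rvec z) = cmod z"
  by (simp add: norm_vec_def L2_set_def sum_2 cmod_def)

lemma inj_rvec: "inj_on rvec A"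
  by (metis cpx_rvec inj_on_inverseI)

lemma rvec_ball: "rvec ` ball x r = ball (rvec x) r"
proof -
  have d: "dist (rvec a) (rvec b) = dist a b" for a b
    by (metis dist_norm linear_diff linear_rvec norm_rvec)
  show ?thesis
    by (auto simp: d image_iff) (metis d mem_ball rvec_cpx)
qed

lemma rvec_cball: "rvec ` cball x r = cball (rvec x) r"
proof -
  have d: "dist (rvec a) (rvec b) = dist a b" for a b
    by (metis dist_norm linear_diff linear_rvec norm_rvec)
  show ?thesis
    by (auto simp: d image_iff) (metis d mem_cball rvec_cpx)
qed

text \<open>
  Every real-linear map of the plane is \<open>v \<mapsto> a v + b (cnj v)\<close>. The case \<open>b = 0\<close> is the differential
  of a holomorphic map, the case \<open>a = 1\<close> the affine map onto an ellipse in the area theorem.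
\<close>
lemma det_real_linear:
  fixes a b :: complex
  shows "det (matrix (\<lambda>v. rvec (a * cpx v + b * cnj (cpx v)))) = (cmod a)\<^sup>2 - (cmod b)\<^sup>2"
proof -
  have "cpx (axis 1 1) = 1" "cpx (axis 2 1) = \<i>"
    by (simp_all add: cpx_def axis_def complex_eq_iff)
  then show ?thesis
    by (simp add: det_2 matrix_def cmod_power2) (simp add: algebra_simps power2_eq_square)
qed

text \<open>
  Iterated integration holds on \<open>real \<times> real\<close>; the coordinate map to \<open>real^2\<close> sends boxes to boxes of
  the same content.
\<close>
lemma has_integral_rectangle_real2:
  fixes f :: "real \<times> real \<Rightarrow> real"
  assumes "continuous_on (cbox (a,c) (b,d)) f"
  shows "((\<lambda>v::real^2. f (v$1, v$2)) has_integral
            integral {a..b} (\<lambda>x. integral {c..d} (\<lambda>y. f (x,y))))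
         (box (vector [a,c]) (vector [b,d]))"
proof -
  let ?g = "\<lambda>v::real^2. (v$1, v$2)" and ?h = "\<lambda>(x,y). vector [x,y] :: real^2"
  have i: "(f has_integral integral {a..b} (\<lambda>x. integral {c..d} (\<lambda>y. f (x,y)))) (cbox (a,c) (b,d))"
    using integral_prod_continuous[OF assms] integrable_continuous[OF assms]
    by (simp add: has_integral_iff)
  have im: "?g ` cbox u v = cbox (u$1,u$2) (v$1,v$2)" for u v
  proof -
    have "(x,y) \<in> ?g ` cbox u v" if "(x,y) \<in> cbox (u$1,u$2) (v$1,v$2)" for x y
      using that by (intro image_eqI[of _ _ "vector [x,y]"]) (auto simp: mem_box_cart forall_2)
    then show ?thesis by (auto simp: mem_box_cart forall_2)
  qed
  have imh: "?h ` cbox u v = cbox (vector [fst u,snd u]) (vector [fst v,snd v])" for u v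
  proof -
    have "w \<in> ?h ` cbox u v" if "w \<in> cbox (vector [fst u,snd u]) (vector [fst v,snd v])" for w
      using that by (intro image_eqI[of _ _ "(w$1,w$2)"]) (cases u; cases v; auto simp: mem_box_cart forall_2 vec_eq_iff)+
    then show ?thesis by (cases u; cases v) (auto simp: mem_box_cart forall_2)
  qed
  have ct: "measure lborel (?g ` cbox u v) = 1 * measure lborel (cbox u v)" for u v
  proof (cases "cbox u v = {}")
    case False
    then have "u$1 \<le> v$1" "u$2 \<le> v$2"
      by (auto simp: interval_ne_empty_cart)
    with False show ?thesis
      unfolding im content_Pair by (simp add: content_cbox_if_cart UNIV_2)
  qed auto
  have "((\<lambda>v. f (?g v)) has_integral (1/1) *\<^sub>R integral {a..b} (\<lambda>x. integral {c..d} (\<lambda>y. f (x,y))))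
          (?h ` cbox (a,c) (b,d))"
  proof (rule has_integral_twiddle[OF _ _ _ _ _ _ ct i])
    show "continuous (at x) ?g" for x :: "real^2"
      by (intro continuous_intros)
    show "\<exists>w z. ?g ` cbox u v = cbox w z" for u v using im by blast
    show "\<exists>w z. ?h ` cbox u v = cbox w z" for u v using imh by blast
  qed (auto simp: vec_eq_iff forall_2)
  then show ?thesis
    unfolding imh by (simp add: has_integral_open_interval)
qed

lemma area_holomorphic_rectangle:
  assumes hol: "L holomorphic_on U" "open U"
    and sub: "\<And>x y. x \<in> {a..b} \<Longrightarrow> y \<in> {c..d} \<Longrightarrow> Complex x y \<in> U"
    and inj: "inj_on L {z. a < Re z \<and> Re z < b \<and> c < Im z \<and> Im z < d}"
  shows "rvec ` L ` {z. a < Re z \<and> Re z < b \<and> c < Im z \<and> Im z < d} \<in> lmeasurable" (is ?A)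
    and "measure lebesgue (rvec ` L ` {z. a < Re z \<and> Re z < b \<and> c < Im z \<and> Im z < d})
         = integral {a..b} (\<lambda>x. integral {c..d} (\<lambda>y. (cmod (deriv L (Complex x y)))\<^sup>2))" (is ?B)
proof -
  let ?Q = "{z. a < Re z \<and> Re z < b \<and> c < Im z \<and> Im z < d}"
  let ?S = "box (vector [a,c]) (vector [b,d]) :: (real^2) set"
  let ?f = "\<lambda>v. rvec (L (cpx v))"
  let ?f' = "\<lambda>v w. rvec (deriv L (cpx v) * cpx w + 0 * cnj (cpx w))"
  have SQ: "?S = rvec ` ?Q"
  proof -
    have "w \<in> rvec ` ?Q" if "w \<in> ?S" for w
      using that by (intro image_eqI[of _ _ "cpx w"]) (auto simp: mem_box_cart forall_2 cpx_def vec_eq_iff)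
    then show ?thesis by (auto simp: mem_box_cart forall_2)
  qed
  have fS: "?f ` ?S = rvec ` L ` ?Q"
    unfolding SQ by (simp add: image_image)
  have der: "(?f has_derivative ?f' v) (at v within ?S)" if v: "v \<in> ?S" for v
  proof -
    have "cpx v \<in> U"
      using v sub[of "v$1" "v$2"] by (auto simp: mem_box_cart forall_2 cpx_def less_imp_le)
    then have "(L has_derivative (\<lambda>w. deriv L (cpx v) * w)) (at (cpx v))"
      using holomorphic_derivI[OF hol(1,2)] by (simp add: has_field_derivative_def)
    moreover have "(cpx has_derivative cpx) (at v within ?S)" "(rvec has_derivative rvec) (at x)" for x
      using linear_cpx linear_rvec by (auto simp: linear_imp_has_derivative linear_conv_bounded_linear bounded_linear_imp_has_derivative)
    ultimately have "((rvec \<circ> (L \<circ> cpx)) has_derivative (rvec \<circ> ((\<lambda>w. deriv L (cpx v) * w) \<circ> cpx))) (at v within ?S)"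
      by (intro diff_chain_within) (auto intro: has_derivative_at_withinI)
    then show ?thesis by (simp add: o_def)
  qed
  have injf: "inj_on ?f ?S"
    unfolding SQ using inj by (auto simp: inj_on_def) (metis cpx_rvec)
  have cont: "continuous_on (cbox (a,c) (b,d)) (\<lambda>p. (cmod (deriv L (Complex (fst p) (snd p))))\<^sup>2)"
  proof -
    have "continuous_on U (deriv L)"
      using hol by (intro holomorphic_on_imp_continuous_on holomorphic_deriv)
    moreover have "continuous_on (cbox (a,c) (b,d)) (\<lambda>p. Complex (fst p) (snd p))"
      unfolding Complex_eq by (intro continuous_intros)
    ultimately have "continuous_on (cbox (a,c) (b,d)) (\<lambda>p. deriv L (Complex (fst p) (snd p)))"
      by (rule continuous_on_compose2) (use sub in auto)
    then show ?thesis by (intro continuous_intros)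
  qed
  have I: "((\<lambda>v. \<bar>det (matrix (?f' v))\<bar>) has_integral 
      integral {a..b} (\<lambda>x. integral {c..d} (\<lambda>y. (cmod (deriv L (Complex x y)))\<^sup>2))) ?S"
    using has_integral_rectangle_real2[OF cont] unfolding det_real_linear
    by (simp add: cpx_def)
  have "?f ` ?S \<in> lmeasurable \<and> measure lebesgue (?f ` ?S) = 
     integral {a..b} (\<lambda>x. integral {c..d} (\<lambda>y. (cmod (deriv L (Complex x y)))\<^sup>2))"
    by (subst has_measure_differentiable_image[OF _ der injf]) (use I in auto)
  then show ?A ?B unfolding fS by auto
qed

section \<open>The area theorem with an omitted disc\<close>

text \<open>
  A point of \<open>K\<close> strictly separated from \<open>C\<close> would give a linear functional whose minimum over \<open>K\<close> is
  attained off \<open>C\<close>, hence at an interior point of \<open>K\<close>, where it can still be decreased.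
\<close>
lemma compact_subset_convex_if_frontier_subset:
  fixes K :: "'a::euclidean_space set"
  assumes K: "compact K" and C: "convex C" "closed C" and fr: "frontier K \<subseteq> C"
  shows "K \<subseteq> C"
proof
  fix x assume x: "x \<in> K"
  show "x \<in> C"
  proof (rule ccontr)
    assume "x \<notin> C"
    then obtain a b where ab: "a \<bullet> x < b" "\<And>y. y \<in> C \<Longrightarrow> a \<bullet> y > b"
      using separating_hyperplane_closed_point[OF C] by blast
    have "continuous_on K (\<lambda>y. a \<bullet> y)" by (intro continuous_intros)
    then obtain k where k: "k \<in> K" "\<And>y. y \<in> K \<Longrightarrow> a \<bullet> k \<le> a \<bullet> y"
      using continuous_attains_inf[OF K] x by blast
    have "k \<notin> C" using k(2)[OF x] ab by fastforce
    then have "k \<in> interior K"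
      using fr k(1) closure_subset by (auto simp: frontier_def)
    then obtain e where e: "e > 0" "cball k e \<subseteq> K"
      using mem_interior_cball by blast
    have "C \<noteq> {}"
      using fr K x by (metis all_not_in_conv compact_imp_bounded frontier_eq_empty not_bounded_UNIV subset_empty)
    then have "a \<noteq> 0" using ab by fastforce
    then have "k - (e / norm a) *\<^sub>R a \<in> cball k e"
      using e by (simp add: dist_norm)
    then have "a \<bullet> k \<le> a \<bullet> (k - (e / norm a) *\<^sub>R a)"
      using e k by blast
    then show False
      using \<open>a \<noteq> 0\<close> e by (simp add: inner_diff_right mult_le_0_iff dot_square_norm zero_le_divide_iff divide_le_0_iff)
  qed
qed

text \<open>
  Near its pole the function \<open>G z = 1 / z + n z\<close> takes all values of large modulus, because \<open>1 / G\<close> extends to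
  an open map that fixes 0. A frontier point of the complement is a limit of values on the punctured
  disc without being one, so it can only come from the bounding circle.
\<close>
lemma complement_of_punctured_image:
  fixes n :: "complex \<Rightarrow> complex"
  assumes n: "n holomorphic_on ball 0 1"
    and inj: "inj_on (\<lambda>z. 1 / z + n z) (ball 0 1 - {0})"
    and r: "0 < r" "r < 1"
  defines "K \<equiv> - (\<lambda>z. 1 / z + n z) ` (ball 0 r - {0})"
  shows "compact K" "frontier K \<subseteq> (\<lambda>z. 1 / z + n z) ` sphere 0 r"
proof -
  let ?G = "\<lambda>z. 1 / z + n z" and ?A = "ball 0 r - {0::complex}"
  have GA: "?G holomorphic_on ?A" "inj_on ?G ?A"
    using r by (auto intro!: holomorphic_intros holomorphic_on_subset[OF n] inj_on_subset[OF inj])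
  have "open (?G ` ?A)"
    by (rule open_mapping_thm3[OF GA(1) _ GA(2)]) auto
  then have cl: "closed K" by (auto simp: K_def)
  have nc: "isCont n z" if "cmod z < 1" for z
    using holomorphic_on_imp_continuous_on[OF n] that
    by (simp add: continuous_on_eq_continuous_at)
  define u where "u = (\<lambda>z. 1 + z * n z)"
  have u: "u holomorphic_on ball 0 1"
    unfolding u_def by (intro holomorphic_intros n)
  have "isCont u 0" unfolding u_def by (intro continuous_intros nc) auto
  then obtain d where d: "d > 0" "\<And>z. cmod z < d \<Longrightarrow> cmod (u z - 1) < 1"
    unfolding continuous_at_eps_delta by (metis dist_norm u_def diff_zero mult_zero_left add.right_neutral zero_less_one)
  define e where "e = min d r"
  have e: "e > 0" "e \<le> r" using d r by (auto simp: e_def)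
  have e3: "u z \<noteq> 0" if "cmod z < e" for z
    using d(2)[of z] that by (auto simp: e_def)
  define H where "H = (\<lambda>z. z / u z)"
  have HG: "H z = 1 / ?G z" "?G z \<noteq> 0" if "cmod z < e" "z \<noteq> 0" for z
    using that e3[of z] by (auto simp: H_def u_def field_simps)
  have H0: "H z = 0 \<longleftrightarrow> z = 0" if "cmod z < e" for z
    using that e3[of z] by (auto simp: H_def)
  have Hhol: "H holomorphic_on ball 0 e"
    unfolding H_def
  proof (rule holomorphic_on_divide[OF holomorphic_on_ident])
    show "u holomorphic_on ball 0 e"
      by (rule holomorphic_on_subset[OF u]) (use e r in auto)
    show "u z \<noteq> 0" if "z \<in> ball 0 e" for z
      using e3[of z] that by simp
  qed
  have Hinj: "inj_on H (ball 0 e)"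
  proof (rule inj_onI)
    fix x y assume xy: "x \<in> ball 0 e" "y \<in> ball 0 e" "H x = H y"
    show "x = y"
    proof (cases "x = 0 \<or> y = 0")
      case True
      then show ?thesis using xy H0 by (metis mem_ball_0)
    next
      case False
      have "1 / ?G x = 1 / ?G y"
        using xy(3) HG(1)[of x] HG(1)[of y] xy(1,2) False by (metis mem_ball_0)
      then have "?G x = ?G y" by (metis inverse_eq_divide inverse_inverse_eq)
      moreover have "x \<in> ?A" "y \<in> ?A" using xy False e by auto
      ultimately show ?thesis by (rule inj_onD[OF GA(2)])
    qed
  qed
  have "open (H ` ball 0 e)" by (rule open_mapping_thm3[OF Hhol _ Hinj]) auto
  moreover have "0 \<in> H ` ball 0 e" using e H0[of 0] by (auto intro!: image_eqI[of _ _ 0])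
  ultimately obtain s where s: "s > 0" "ball 0 s \<subseteq> H ` ball 0 e"
    using open_contains_ball by blast
  have "K \<subseteq> cball 0 (1 / s)"
  proof
    fix w assume w: "w \<in> K"
    show "w \<in> cball 0 (1/s)"
    proof (rule ccontr)
      assume "w \<notin> cball 0 (1/s)"
      then have l: "cmod w > 1 / s" by auto
      then have w0: "w \<noteq> 0" using s by (auto simp: divide_less_0_iff)
      then have "cmod (1 / w) < s" using l s by (simp add: norm_divide field_simps)
      then obtain z where z: "cmod z < e" "1 / w = H z" using s by force
      then have "z \<noteq> 0" using w0 by (auto simp: H_def)
      with z HG[of z] w0 have "w = ?G z" by (simp add: field_simps)
      with w z \<open>z \<noteq> 0\<close> e show False unfolding K_def by (auto simp: image_iff)
    qed
  qed
  then have "bounded K" using bounded_cball bounded_subset by blast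
  with cl show "compact K" by (simp add: compact_eq_bounded_closed)
  show "frontier K \<subseteq> ?G ` sphere 0 r"
  proof
    fix w assume w: "w \<in> frontier K"
    then have wK: "w \<in> K" using cl frontier_subset_eq by blast
    have "w \<in> closure (?G ` ?A)"
      using w unfolding K_def by (simp add: frontier_closures)
    then obtain x where x: "\<And>i. x i \<in> ?G ` ?A" "x \<longlonglongrightarrow> w"
      by (auto simp: closure_sequential)
    then have "\<forall>i. \<exists>y. y \<in> ?A \<and> x i = ?G y" by blast
    then obtain y where y: "\<And>i. y i \<in> ?A" "\<And>i. x i = ?G (y i)" by metis
    have "\<And>i. y i \<in> cball 0 r" using y(1) by (simp add: less_imp_le)
    then obtain l \<sigma> where l: "l \<in> cball 0 r" "strict_mono \<sigma>" "(y \<circ> \<sigma>) \<longlonglongrightarrow> l"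
      using compact_cball[of 0 r] unfolding compact_def by meson
    have xs: "(x \<circ> \<sigma>) \<longlonglongrightarrow> w" using LIMSEQ_subseq_LIMSEQ[OF x(2) l(2)] .
    have nl: "(\<lambda>i. n ((y \<circ> \<sigma>) i)) \<longlonglongrightarrow> n l"
      by (rule isCont_tendsto_compose[OF nc l(3)]) (use l r in auto)
    have "(\<lambda>i. (y \<circ> \<sigma>) i * (x \<circ> \<sigma>) i) \<longlonglongrightarrow> l * w" by (intro tendsto_intros l xs)
    moreover have "(\<lambda>i. (y \<circ> \<sigma>) i * (x \<circ> \<sigma>) i) = (\<lambda>i. 1 + (y \<circ> \<sigma>) i * n ((y \<circ> \<sigma>) i))"
      using y by (auto simp: fun_eq_iff field_simps)
    moreover have "(\<lambda>i. 1 + (y \<circ> \<sigma>) i * n ((y \<circ> \<sigma>) i)) \<longlonglongrightarrow> 1 + l * n l"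
      by (intro tendsto_intros l nl)
    ultimately have eq: "l * w = 1 + l * n l" by (metis LIMSEQ_unique)
    then have "l \<noteq> 0" by auto
    then have "w = ?G l" using eq by (simp add: field_simps)
    moreover have "cmod l = r"
    proof (rule ccontr)
      assume "cmod l \<noteq> r"
      then have "l \<in> ?A" using l \<open>l \<noteq> 0\<close> by auto
      then show False using wK \<open>w = ?G l\<close> by (auto simp: K_def)
    qed
    ultimately show "w \<in> ?G ` sphere 0 r" by auto
  qed
qed

lemma circle_integral_vanishes:
  fixes P :: "complex \<Rightarrow> complex"
  assumes P: "P holomorphic_on ball 0 1" and P0: "P 0 = 0" and \<rho>: "0 < \<rho>" "\<rho> < 1"
  shows "((\<lambda>t. P (of_real \<rho> * cis t)) has_integral 0) {0..2*pi}"
proof -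
  obtain Q where Q: "Q holomorphic_on ball 0 1" "\<And>z. cmod z < 1 \<Longrightarrow> P z = z * Q z"
    using Schwarz3[OF P P0] by metis
  have "(Q has_contour_integral 0) (circlepath 0 \<rho>)"
    by (rule Cauchy_theorem_convex_simple[OF Q(1)]) (use \<rho> in auto)
  then have "((\<lambda>t. Q (of_real \<rho> * cis t) * \<rho> * \<i> * cis t) has_integral 0) {0..2*pi}"
    unfolding circlepath_def by (subst (asm) has_contour_integral_part_circlepath_iff) auto
  then have "((\<lambda>t. -\<i> * (Q (of_real \<rho> * cis t) * \<rho> * \<i> * cis t)) has_integral -\<i> * 0) {0..2*pi}"
    by (rule has_integral_mult_right)
  moreover have "-\<i> * (Q (of_real \<rho> * cis t) * \<rho> * \<i> * cis t) = P (of_real \<rho> * cis t)" for t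
    using Q(2)[of "of_real \<rho> * cis t"] \<rho> by (simp add: norm_mult algebra_simps)
  ultimately show ?thesis by simp
qed

text \<open>
  For \<open>G z = 1 / z + n z\<close> the integrand is the squared modulus of \<open>z * deriv G z\<close>. By orthogonality of the
  powers of \<open>z\<close> on the circle its mean is the sum of the contributions of all coefficients; only those
  of \<open>1 / z\<close> and of \<open>z\<close> are kept.
\<close>
lemma circle_mean_lower_bound:
  fixes n :: "complex \<Rightarrow> complex"
  assumes n: "n holomorphic_on ball 0 1" and \<rho>: "0 < \<rho>" "\<rho> < 1"
  shows "integral {0..2*pi} (\<lambda>t. (cmod (- 1 / (of_real \<rho> * cis t)
              + of_real \<rho> * cis t * deriv n (of_real \<rho> * cis t)))\<^sup>2)
         \<ge> 2 * pi * (1 / \<rho>\<^sup>2 + (cmod (deriv n 0))\<^sup>2 * \<rho>\<^sup>2)"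
proof -
  define b where "b = deriv n 0"
  have dn: "deriv n holomorphic_on ball 0 1" by (intro holomorphic_deriv n) auto
  have "(\<lambda>z. deriv n z - b) holomorphic_on ball 0 1"
    by (intro holomorphic_intros dn)
  then obtain m where m: "m holomorphic_on ball 0 1"
      "\<And>z. cmod z < 1 \<Longrightarrow> deriv n z - b = z * m z"
    by (rule Schwarz3) (auto simp: b_def)
  \<comment> \<open>On the circle \<open>cnj z = \<rho>\<^sup>2 / z\<close>, which turns the cross terms of the squared modulus into the
    real part of a holomorphic function that vanishes at 0.\<close>
  define P where "P = (\<lambda>z. 2 * (- b * z\<^sup>2 / of_real \<rho>^2 - z^3 * m z / of_real \<rho>^2 + cnj b * of_real \<rho>^2 * z * m z))"
  have P: "P holomorphic_on ball 0 1" "P 0 = 0"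
    unfolding P_def using \<rho> by (auto intro!: holomorphic_intros m)
  let ?z = "\<lambda>t. of_real \<rho> * cis t"
  let ?f = "\<lambda>t. (cmod (- 1 / ?z t + ?z t * deriv n (?z t)))\<^sup>2"
  have i1: "((\<lambda>t. Re (P (?z t))) has_integral Re 0) {0..2*pi}"
    by (intro has_integral_linear[OF circle_integral_vanishes[OF P \<rho>] bounded_linear_Re, unfolded o_def])
  have lo: "((\<lambda>t. (1 / \<rho>\<^sup>2 + (cmod b)\<^sup>2 * \<rho>\<^sup>2) + Re (P (?z t))) has_integral
          (2 * pi - 0) *\<^sub>R (1 / \<rho>\<^sup>2 + (cmod b)\<^sup>2 * \<rho>\<^sup>2) + Re 0) {0..2*pi}"
    by (intro has_integral_add i1) (use has_integral_const_real[of "1 / \<rho>\<^sup>2 + (cmod b)\<^sup>2 * \<rho>\<^sup>2" 0 "2*pi"] in simp)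
  have hi: "(?f has_integral integral {0..2*pi} ?f) {0..2*pi}"
  proof (intro integrable_integral integrable_continuous_interval continuous_intros
      continuous_on_compose2[OF holomorphic_on_imp_continuous_on[OF dn]])
  qed (use \<rho> in \<open>auto simp: norm_mult\<close>)
  have pw: "(1 / \<rho>\<^sup>2 + (cmod b)\<^sup>2 * \<rho>\<^sup>2) + Re (P (?z t)) \<le> ?f t" for t
  proof -
    define z where "z = ?z t"
    have z: "cmod z = \<rho>" "z \<noteq> 0" using \<rho> by (auto simp: z_def norm_mult)
    have zz: "z * cnj z = of_real \<rho>^2" using z by (metis complex_norm_square of_real_power)
    define A where "A = - 1 / z + b * z"
    define B where "B = z\<^sup>2 * m z"
    have d: "deriv n z = b + z * m z" using m(2)[of z] z \<rho> by (simp add: algebra_simps)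
    have zA: "- 1 / z + z * deriv n z = A + B"
      by (simp add: A_def B_def d algebra_simps power2_eq_square)
    \<comment> \<open>The term \<open>(cmod B)\<^sup>2\<close> carries all higher coefficients and is dropped.\<close>
    have norm2: "(cmod (A + B))\<^sup>2 = (cmod A)\<^sup>2 + 2 * Re (cnj A * B) + (cmod B)\<^sup>2"
      unfolding cmod_power2 by (simp add: algebra_simps power2_eq_square)
    have A2: "(cmod A)\<^sup>2 = 1 / \<rho>\<^sup>2 + (cmod b)\<^sup>2 * \<rho>\<^sup>2 - 2 * Re (b * z * cnj (1 / z))"
    proof -
      have "(cmod (x + y))\<^sup>2 = (cmod x)\<^sup>2 + (cmod y)\<^sup>2 + 2 * Re (y * cnj x)" for x y
        unfolding cmod_power2 by (simp add: algebra_simps power2_eq_square)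
      from this[of "-1/z" "b*z"] show ?thesis
        using z by (simp add: A_def norm_mult norm_divide power_mult_distrib power_divide)
    qed
    have c: "cnj (1 / z) = z / of_real \<rho>^2" "cnj z = of_real \<rho>^2 / z"
      using zz z \<rho> by (auto simp: field_simps)
    have "P z = 2 * (cnj A * B) - 2 * (b * z * cnj (1 / z))"
    proof -
      have cA: "cnj A = - (z / of_real \<rho>^2) + cnj b * (of_real \<rho>^2 / z)"
        using c by (simp add: A_def)
      show ?thesis unfolding c cA P_def B_def using z \<rho>
        by (simp add: field_simps power2_eq_square power3_eq_cube)
    qed
    moreover have sc: "Re (2 * q - 2 * w) = 2 * Re q - 2 * Re w" for q w by simp
    ultimately have "Re (P z) = 2 * Re (cnj A * B) - 2 * Re (b * z * cnj (1 / z))"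
      by metis
    then show ?thesis unfolding z_def[symmetric] norm2 A2 zA by simp
  qed
  show ?thesis
    using has_integral_le[OF lo hi pw] unfolding b_def by simp
qed

text \<open>
  The map \<open>G \<circ> exp\<close> is injective on a rectangle of height \<open>2 * pi\<close> that covers the annulus up to a slit, and the
  squared modulus of its derivative is integrated by circles. The slit is why only a subset \<open>X\<close> of
  the image of the annulus appears.
\<close>
lemma annulus_image_area:
  fixes n :: "complex \<Rightarrow> complex"
  assumes n: "n holomorphic_on ball 0 1"
    and inj: "inj_on (\<lambda>z. 1 / z + n z) (ball 0 1 - {0})"
    and rs: "0 < r" "r < s" "s < 1"
  obtains X where "X \<subseteq> (\<lambda>z. 1 / z + n z) ` {z. r < cmod z \<and> cmod z < s}"
    "rvec ` X \<in> lmeasurable"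
    "measure lebesgue (rvec ` X) \<ge> pi * (1 / r\<^sup>2 - 1 / s\<^sup>2 + (cmod (deriv n 0))\<^sup>2 * (s\<^sup>2 - r\<^sup>2))"
proof -
  let ?G = "\<lambda>z. 1 / z + n z"
  define L where "L = (\<lambda>\<zeta>. ?G (exp \<zeta>))"
  let ?Q = "{z. ln r < Re z \<and> Re z < ln s \<and> 0 < Im z \<and> Im z < 2*pi}"
  have dL: "(L has_field_derivative (- 1 / exp \<zeta> + exp \<zeta> * deriv n (exp \<zeta>))) (at \<zeta>)"
    if "Re \<zeta> < 0" for \<zeta>
  proof -
    have "(n has_field_derivative deriv n (exp \<zeta>)) (at (exp \<zeta>))"
      by (rule holomorphic_derivI[OF n]) (use that in auto)
    then show ?thesis
      unfolding L_def by (auto intro!: derivative_eq_intros DERIV_chain2[of n] simp: field_simps power2_eq_square)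
  qed
  have hol: "L holomorphic_on {z. Re z < 0}"
    using dL by (subst holomorphic_on_open) (auto simp: open_halfspace_Re_lt)
  have im: "exp ` ?Q \<subseteq> {z. r < cmod z \<and> cmod z < s}"
    using rs by auto (metis exp_less_mono exp_ln order_less_trans)+
  have injL: "inj_on L ?Q"
  proof (rule inj_onI)
    fix x y assume xy: "x \<in> ?Q" "y \<in> ?Q" "L x = L y"
    have "exp x \<in> ball 0 1 - {0}" "exp y \<in> ball 0 1 - {0}"
      using xy(1,2) rs by (auto intro: less_trans)
    then have "exp x = exp y" using xy(3) inj_onD[OF inj] unfolding L_def by blast
    then show "x = y" by (rule exp_complex_eqI[rotated]) (use xy in auto)
  qed
  have sub: "Complex x y \<in> {z. Re z < 0}" if "x \<in> {ln r..ln s}" "y \<in> {0..2*pi}" for x y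
    using that rs by (auto intro: le_less_trans)
  have op: "open {z. Re z < 0}" by (rule open_halfspace_Re_lt)
  have area1: "rvec ` L ` ?Q \<in> lmeasurable"
    by (rule area_holomorphic_rectangle(1)[OF hol op sub injL])
  let ?I = "\<lambda>x. integral {0..2*pi} (\<lambda>y. (cmod (deriv L (Complex x y)))\<^sup>2)"
  let ?b = "(cmod (deriv n 0))\<^sup>2"
  have lower: "?I x \<ge> 2 * pi * (exp (-2*x) + ?b * exp (2*x))" if x: "x \<in> {ln r..ln s}" for x
  proof -
    have x0: "x < 0" using x rs by (auto intro: le_less_trans)
    have e: "exp (Complex x y) = of_real (exp x) * cis y" for y
      by (simp add: exp_eq_polar)
    have dLx: "deriv L (Complex x y) = - 1 / (of_real (exp x) * cis y)
              + of_real (exp x) * cis y * deriv n (of_real (exp x) * cis y)" for y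
      using DERIV_imp_deriv[OF dL[of "Complex x y"]] x0 by (simp only: e complex.sel)
    have "1 / (exp x)\<^sup>2 = exp (-2*x)" "(exp x)\<^sup>2 = exp (2*x)"
      by (simp_all add: exp_double exp_minus inverse_eq_divide)
    then show ?thesis
      using circle_mean_lower_bound[OF n, of "exp x"] x0 unfolding dLx by simp
  qed
  have cI: "continuous_on {ln r..ln s} ?I"
  proof -
    have "continuous_on {z. Re z < 0} (deriv L)"
      by (intro holomorphic_on_imp_continuous_on holomorphic_deriv hol op)
    moreover have "continuous_on ({ln r..ln s} \<times> cbox 0 (2*pi)) (\<lambda>p. Complex (fst p) (snd p))"
      unfolding Complex_eq by (intro continuous_intros)
    ultimately have "continuous_on ({ln r..ln s} \<times> cbox 0 (2*pi)) (\<lambda>p. deriv L (Complex (fst p) (snd p)))"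
      by (rule continuous_on_compose2) (use sub in auto)
    then have "continuous_on ({ln r..ln s} \<times> cbox 0 (2*pi)) (\<lambda>(x,y). (cmod (deriv L (Complex x y)))\<^sup>2)"
      unfolding case_prod_unfold by (intro continuous_on_power continuous_on_norm)
    from integral_continuous_on_param[OF this] show ?thesis by simp
  qed
  have FTC: "((\<lambda>x. 2 * pi * (exp (-2*x) + ?b * exp (2*x))) has_integral
       (pi * (- exp (-2 * ln s) + ?b * exp (2 * ln s)) - pi * (- exp (-2 * ln r) + ?b * exp (2 * ln r)))) {ln r..ln s}"
    by (rule fundamental_theorem_of_calculus[where f="\<lambda>x. pi * (- exp (-2 * x) + ?b * exp (2 * x))"])
       (use rs in \<open>auto intro!: derivative_eq_intros simp: has_real_derivative_iff_has_vector_derivative[symmetric] algebra_simps\<close>)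
  have ex: "exp (-2 * ln t) = 1 / t\<^sup>2" "exp (2 * ln t) = t\<^sup>2" if "t > 0" for t :: real
    using that by (simp_all add: exp_minus exp_double inverse_eq_divide)
  have "pi * (1 / r\<^sup>2 - 1 / s\<^sup>2 + ?b * (s\<^sup>2 - r\<^sup>2)) =
     (pi * (- exp (-2 * ln s) + ?b * exp (2 * ln s)) - pi * (- exp (-2 * ln r) + ?b * exp (2 * ln r)))"
    using rs by (simp only: ex) (simp add: algebra_simps ex)
  also have "\<dots> \<le> integral {ln r..ln s} ?I"
    by (rule has_integral_le[OF FTC integrable_integral[OF integrable_continuous_interval[OF cI]] lower])
  also have "\<dots> = measure lebesgue (rvec ` L ` ?Q)"
    by (rule area_holomorphic_rectangle(2)[OF hol op sub injL, symmetric])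
  finally have m: "measure lebesgue (rvec ` L ` ?Q) \<ge> pi * (1 / r\<^sup>2 - 1 / s\<^sup>2 + ?b * (s\<^sup>2 - r\<^sup>2))" .
  have "L ` ?Q = ?G ` exp ` ?Q" by (simp add: L_def image_image)
  then have "L ` ?Q \<subseteq> ?G ` {z. r < cmod z \<and> cmod z < s}" using im by blast
  then show ?thesis using area1 m by (rule that)
qed

text \<open>
  On the circle of radius \<open>r\<close> one has \<open>b * z = b * r\<^sup>2 * cnj (1 / z)\<close>, so \<open>1 / z + b * z\<close> is a real-linear function
  of \<open>u = 1 / z\<close> there and traces an ellipse. The remaining Taylor terms are of order \<open>r\<^sup>2\<close> and only enlarge
  the ellipse slightly. A disc instead of the ellipse would be too crude: its area exceeds
  that of the ellipse by an amount that does not tend to 0 with \<open>r\<close>.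
\<close>
lemma complement_in_ellipse:
  fixes n :: "complex \<Rightarrow> complex"
  assumes n: "n holomorphic_on ball 0 1"
    and inj: "inj_on (\<lambda>z. 1 / z + n z) (ball 0 1 - {0})"
  shows "\<exists>C\<ge>0. \<forall>r. 0 < r \<and> r \<le> 1/2 \<and> cmod (deriv n 0) * r\<^sup>2 \<le> 1/2 \<longrightarrow>
      - (\<lambda>z. 1 / z + n z) ` (ball 0 r - {0}) \<subseteq>
      (\<lambda>u. n 0 + (u + deriv n 0 * of_real (r\<^sup>2) * cnj u)) ` cball 0 (1 / r + C * r\<^sup>2)"
proof -
  define b where "b = deriv n 0"
  obtain p where p: "p holomorphic_on ball 0 1" "\<And>z. cmod z < 1 \<Longrightarrow> n z - n 0 = z * p z"
     "deriv (\<lambda>z. n z - n 0) 0 = p 0"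
    by (rule Schwarz3[of "\<lambda>z. n z - n 0" 1]) (auto intro!: holomorphic_intros n)
  have "(n has_field_derivative b) (at 0)"
    unfolding b_def by (rule holomorphic_derivI[OF n]) auto
  then have "((\<lambda>z. n z - n 0) has_field_derivative b) (at 0)"
    by (auto intro!: derivative_eq_intros)
  then have p0: "p 0 = b" using p(3) DERIV_imp_deriv by metis
  obtain q where q: "q holomorphic_on ball 0 1" "\<And>z. cmod z < 1 \<Longrightarrow> p z - b = z * q z"
    by (rule Schwarz3[of "\<lambda>z. p z - b" 1]) (auto intro!: holomorphic_intros p simp: p0)
  have "continuous_on (cball 0 (1/2)) q"
    by (rule continuous_on_subset[OF holomorphic_on_imp_continuous_on[OF q(1)]]) auto
  then have "bounded (q ` cball 0 (1/2))"
    by (intro compact_imp_bounded compact_continuous_image) auto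
  then obtain C where C: "C > 0" "\<And>z. z \<in> cball 0 (1/2) \<Longrightarrow> cmod (q z) \<le> C"
    unfolding bounded_pos by blast
  show ?thesis
  proof (intro exI[of _ "2 * C"] conjI allI impI)
    fix r :: real
    assume "0 < r \<and> r \<le> 1/2 \<and> cmod (deriv n 0) * r\<^sup>2 \<le> 1/2"
    then have r: "0 < r" "r \<le> 1/2" and br: "cmod (deriv n 0) * r\<^sup>2 \<le> 1/2" by auto
    define \<beta> where "\<beta> = b * of_real (r\<^sup>2)"
    have \<beta>: "cmod \<beta> \<le> 1/2" using br by (simp add: \<beta>_def b_def norm_mult norm_power)
    let ?T = "\<lambda>u. n 0 + (u + \<beta> * cnj u)"
    let ?E = "?T ` cball 0 (1 / r + 2 * C * r\<^sup>2)"
    have lin: "linear (\<lambda>u. u + \<beta> * cnj u)"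
      by (auto intro!: linearI simp: algebra_simps scaleR_conv_of_real)
    have Teq: "?E = (+) (n 0) ` (\<lambda>u. u + \<beta> * cnj u) ` cball 0 (1 / r + 2 * C * r\<^sup>2)"
      by (simp add: image_image)
    have conv: "convex ?E"
      unfolding Teq by (intro convex_translation convex_linear_image lin convex_cball)
    have "compact ?E"
      by (intro compact_continuous_image continuous_intros) auto
    then have clo: "closed ?E" by (rule compact_imp_closed)
    have "1 / z + n z \<in> ?E" if z: "cmod z = r" for z
    proof -
      have z0: "z \<noteq> 0" "cmod z < 1" using z r by auto
      have zz: "z * cnj z = of_real (r\<^sup>2)" using z by (metis complex_norm_square)
      define e where "e = z\<^sup>2 * q z"
      have e: "cmod e \<le> C * r\<^sup>2"
        using C(2)[of z] z r by (simp add: e_def norm_mult norm_power mult.commute)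
      have nz: "n z = n 0 + b * z + e"
        using p(2)[of z] q(2)[of z] z0 by (simp add: e_def algebra_simps power2_eq_square)
      \<comment> \<open>\<open>v\<close> is the preimage of the Taylor remainder \<open>e\<close> under \<open>u \<mapsto> u + \<beta> * cnj u\<close>, whose
        determinant is \<open>D\<close>.\<close>
      define D where "D = 1 - (cmod \<beta>)\<^sup>2"
      have D: "D = (1 + cmod \<beta>) * (1 - cmod \<beta>)" "D > 0"
      proof -
        show "D = (1 + cmod \<beta>) * (1 - cmod \<beta>)"
          by (simp add: D_def algebra_simps power2_eq_square)
        then show "D > 0"
          using \<beta> by (simp add: add_pos_nonneg)
      qed
      define v where "v = (e - \<beta> * cnj e) / of_real D"
      have Dc: "of_real D = 1 - \<beta> * cnj \<beta>"
        by (simp add: D_def complex_norm_square[symmetric])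
      have "v + \<beta> * cnj v = (e - \<beta> * cnj e + \<beta> * (cnj e - cnj \<beta> * e)) / of_real D"
        by (simp add: v_def add_divide_distrib)
      also have "\<dots> = e * (1 - \<beta> * cnj \<beta>) / of_real D" by (simp add: algebra_simps)
      also have "\<dots> = e" using D(2) unfolding Dc[symmetric] by simp
      finally have ve: "v + \<beta> * cnj v = e" .
      have "cmod (e - \<beta> * cnj e) \<le> cmod e + cmod \<beta> * cmod e"
        by (metis norm_triangle_ineq4 norm_mult complex_mod_cnj)
      then have "cmod v \<le> (1 + cmod \<beta>) * cmod e / D"
        using D(2) by (simp add: v_def norm_divide algebra_simps divide_right_mono)
      also have "\<dots> = cmod e / (1 - cmod \<beta>)"
        using \<beta> unfolding D(1) by (metis add_pos_nonneg mult_divide_mult_cancel_left norm_ge_zero order_less_irrefl zero_less_one)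
      also have "\<dots> \<le> cmod e / (1/2)" using \<beta> by (intro divide_left_mono) auto
      finally have v: "cmod v \<le> 2 * C * r\<^sup>2" using e by simp
      have "cmod (1 / z + v) \<le> 1 / r + 2 * C * r\<^sup>2"
        using norm_triangle_ineq[of "1/z" v] v z by (simp add: norm_divide)
      moreover have "\<beta> * cnj (1 / z) = b * z"
        using z0(1) unfolding \<beta>_def zz[symmetric] by simp
      then have "?T (1 / z + v) = 1 / z + n z"
        unfolding nz using ve by (simp add: algebra_simps)
      ultimately show ?thesis by (intro image_eqI[of _ _ "1 / z + v"]) auto
    qed
    then have fr: "(\<lambda>z. 1 / z + n z) ` sphere 0 r \<subseteq> ?E" by auto
    have "r < 1" using r by simp
    note K = complement_of_punctured_image[OF n inj r(1) this]
    have "- (\<lambda>z. 1 / z + n z) ` (ball 0 r - {0}) \<subseteq> ?E"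
      by (rule compact_subset_convex_if_frontier_subset[OF K(1) conv clo]) (use K(2) fr in blast)
    then show "- (\<lambda>z. 1 / z + n z) ` (ball 0 r - {0}) \<subseteq>
      (\<lambda>u. n 0 + (u + deriv n 0 * of_real (r\<^sup>2) * cnj u)) ` cball 0 (1 / r + 2 * C * r\<^sup>2)"
      unfolding \<beta>_def b_def .
  next
    show "0 \<le> 2 * C" using C(1) by simp
  qed
qed

lemma ellipse_area_le:
  assumes "R \<ge> 0" "cmod \<beta> \<le> 1"
  shows "rvec ` (\<lambda>u. c + (u + \<beta> * cnj u)) ` cball 0 R \<in> lmeasurable"
    "measure lebesgue (rvec ` (\<lambda>u. c + (u + \<beta> * cnj u)) ` cball 0 R) \<le> pi * R\<^sup>2"
proof -
  let ?T = "\<lambda>v. rvec (1 * cpx v + \<beta> * cnj (cpx v))"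
  have rl: "rvec (a + b) = rvec a + rvec b" for a b by (rule linear_add[OF linear_rvec])
  have E: "rvec ` (\<lambda>u. c + (u + \<beta> * cnj u)) ` cball 0 R = (+) (rvec c) ` ?T ` cball (rvec 0) R"
    unfolding rvec_cball[symmetric] image_image by (simp add: rl)
  have "linear (\<lambda>w. 1 * w + \<beta> * cnj w)"
    by (auto intro!: linearI simp: algebra_simps scaleR_conv_of_real)
  then have lin: "linear ?T"
    using linear_compose[OF linear_compose[OF linear_cpx] linear_rvec] by (simp add: o_def)
  have cb: "cball (rvec 0) R \<in> lmeasurable" by simp
  have mb: "measure lebesgue (cball (rvec 0) R) = pi * R\<^sup>2"
    using assms content_cball[of R "rvec 0"] by (simp add: unit_ball_vol_2)
  show "rvec ` (\<lambda>u. c + (u + \<beta> * cnj u)) ` cball 0 R \<in> lmeasurable"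
    unfolding E by (intro measurable_translation measurable_linear_image lin cb)
  have "\<bar>1 - (cmod \<beta>)\<^sup>2\<bar> \<le> 1"
    using assms by (auto simp: abs_square_le_1)
  then have "\<bar>1 - (cmod \<beta>)\<^sup>2\<bar> * (pi * R\<^sup>2) \<le> 1 * (pi * R\<^sup>2)"
    by (intro mult_right_mono) auto
  then show "measure lebesgue (rvec ` (\<lambda>u. c + (u + \<beta> * cnj u)) ` cball 0 R) \<le> pi * R\<^sup>2"
    unfolding E measure_translation measure_linear_image[OF lin cb] det_real_linear mb
    by simp
qed

text \<open>
  Gronwall's area theorem. The ellipse of area at most about \<open>pi / r\<^sup>2\<close> contains two disjoint sets, the image of
  the annulus between radii \<open>r\<close> and \<open>s\<close>, and the omitted disc. Comparing areas and letting \<open>s\<close> tend to 1 and \<open>r\<close>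
  to 0 leaves the inequality; a disc in the omitted set is what makes it strict.
\<close>
theorem area_theorem_with_omitted_disc:
  fixes n :: "complex \<Rightarrow> complex"
  assumes n: "n holomorphic_on ball 0 1"
    and inj: "inj_on (\<lambda>z. 1 / z + n z) (ball 0 1 - {0})"
    and om: "ball x \<delta> \<inter> (\<lambda>z. 1 / z + n z) ` (ball 0 1 - {0}) = {}" and \<delta>: "\<delta> \<ge> 0"
  shows "(cmod (deriv n 0))\<^sup>2 + \<delta>\<^sup>2 \<le> 1"
proof -
  let ?G = "\<lambda>z. 1 / z + n z" and ?b = "(cmod (deriv n 0))\<^sup>2"
  obtain C where C: "C \<ge> 0"
    "\<forall>r. 0 < r \<and> r \<le> 1/2 \<and> cmod (deriv n 0) * r\<^sup>2 \<le> 1/2 \<longrightarrow>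
      - ?G ` (ball 0 r - {0}) \<subseteq>
      (\<lambda>u. n 0 + (u + deriv n 0 * of_real (r\<^sup>2) * cnj u)) ` cball 0 (1 / r + C * r\<^sup>2)"
    using complement_in_ellipse[OF n inj] by (elim exE conjE) (rule that)
  have 1: "1 / r\<^sup>2 - 1 / s\<^sup>2 + ?b * (s\<^sup>2 - r\<^sup>2) + \<delta>\<^sup>2 \<le> (1 / r + C * r\<^sup>2)\<^sup>2"
    if r: "0 < r" "r \<le> 1/2" "cmod (deriv n 0) * r\<^sup>2 \<le> 1/2" and s: "r < s" "s < 1" for r s
  proof -
    let ?E = "(\<lambda>u. n 0 + (u + deriv n 0 * of_real (r\<^sup>2) * cnj u)) ` cball 0 (1 / r + C * r\<^sup>2)"
    obtain X where X: "X \<subseteq> ?G ` {z. r < cmod z \<and> cmod z < s}" "rvec ` X \<in> lmeasurable"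
      "measure lebesgue (rvec ` X) \<ge> pi * (1 / r\<^sup>2 - 1 / s\<^sup>2 + ?b * (s\<^sup>2 - r\<^sup>2))"
      using annulus_image_area[OF n inj r(1) s] by blast
    have KE: "- ?G ` (ball 0 r - {0}) \<subseteq> ?E"
      using C(2) r by blast
    have XK: "X \<subseteq> - ?G ` (ball 0 r - {0})"
    proof
      fix w assume "w \<in> X"
      then obtain z where z: "r < cmod z" "cmod z < s" "w = ?G z" using X(1) by auto
      have False if y: "y \<in> ball 0 r - {0}" "w = ?G y" for y
      proof -
        have "z = y" by (rule inj_onD[OF inj]) (use z s r y in auto)
        then show False using y z by auto
      qed
      then show "w \<in> - ?G ` (ball 0 r - {0})" by blast
    qed
    have BK: "ball x \<delta> \<subseteq> - ?G ` (ball 0 r - {0})"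
    proof -
      have "ball 0 r - {0} \<subseteq> ball 0 1 - {0::complex}" using r by auto
      then show ?thesis using om by (meson ComplI disjoint_iff image_mono subset_iff)
    qed
    have sub: "rvec ` X \<union> rvec ` ball x \<delta> \<subseteq> rvec ` ?E"
      by (rule Un_least; rule image_mono; rule order_trans[OF _ KE], rule XK BK)
    have "{z. r < cmod z \<and> cmod z < s} \<subseteq> ball 0 1 - {0}" using r s by auto
    then have "X \<subseteq> ?G ` (ball 0 1 - {0})" using X(1) by (meson image_mono order_trans)
    then have "X \<inter> ball x \<delta> = {}" using om by blast
    then have disj: "rvec ` X \<inter> rvec ` ball x \<delta> = {}"
      by (metis image_Int image_empty inj_rvec)
    have bm: "rvec ` ball x \<delta> \<in> lmeasurable" "measure lebesgue (rvec ` ball x \<delta>) = pi * \<delta>\<^sup>2"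
      using \<delta> content_ball[of \<delta> "rvec x"] by (simp_all add: rvec_ball unit_ball_vol_2)
    have b1: "cmod (deriv n 0 * of_real (r\<^sup>2)) \<le> 1"
      using r by (simp add: norm_mult norm_power)
    have R: "0 \<le> 1 / r + C * r\<^sup>2" using r C by simp
    have "pi * (1 / r\<^sup>2 - 1 / s\<^sup>2 + ?b * (s\<^sup>2 - r\<^sup>2)) + pi * \<delta>\<^sup>2
        \<le> measure lebesgue (rvec ` X) + measure lebesgue (rvec ` ball x \<delta>)"
      using X(3) bm by simp
    also have "\<dots> = measure lebesgue (rvec ` X \<union> rvec ` ball x \<delta>)"
      using measure_Un3[OF X(2) bm(1)] disj by simp
    also have "\<dots> \<le> measure lebesgue (rvec ` ?E)"
      by (rule measure_mono_fmeasurable[OF sub _ ellipse_area_le(1)[OF R b1]])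
         (use X bm in \<open>auto intro: fmeasurableD\<close>)
    also have "\<dots> \<le> pi * (1 / r + C * r\<^sup>2)\<^sup>2" by (rule ellipse_area_le(2)[OF R b1])
    finally have "pi * (1 / r\<^sup>2 - 1 / s\<^sup>2 + ?b * (s\<^sup>2 - r\<^sup>2) + \<delta>\<^sup>2) \<le> pi * (1 / r + C * r\<^sup>2)\<^sup>2"
      by (simp add: algebra_simps)
    then show ?thesis by (simp add: mult_le_cancel_left_pos)
  qed
  \<comment> \<open>Let \<open>s\<close> tend to 1; the terms \<open>1 / r\<^sup>2\<close> then cancel, and \<open>r\<close> can tend to 0.\<close>
  have 2: "?b + \<delta>\<^sup>2 \<le> 1 + ?b * r\<^sup>2 + 2 * C * r + C\<^sup>2 * r^4"
    if r: "0 < r" "r \<le> 1/2" "cmod (deriv n 0) * r\<^sup>2 \<le> 1/2" for r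
  proof -
    have "((\<lambda>s. 1 / r\<^sup>2 - 1 / s\<^sup>2 + ?b * (s\<^sup>2 - r\<^sup>2) + \<delta>\<^sup>2) \<longlongrightarrow>
             1 / r\<^sup>2 - 1 / 1\<^sup>2 + ?b * (1\<^sup>2 - r\<^sup>2) + \<delta>\<^sup>2) (at_left 1)"
      by (intro tendsto_intros) auto
    moreover have "\<forall>\<^sub>F s in at_left 1. 1 / r\<^sup>2 - 1 / s\<^sup>2 + ?b * (s\<^sup>2 - r\<^sup>2) + \<delta>\<^sup>2 \<le> (1 / r + C * r\<^sup>2)\<^sup>2"
      unfolding eventually_at_left_field using 1[OF r] r by (intro exI[of _ r]) auto
    ultimately have "1 / r\<^sup>2 - 1 / 1\<^sup>2 + ?b * (1\<^sup>2 - r\<^sup>2) + \<delta>\<^sup>2 \<le> (1 / r + C * r\<^sup>2)\<^sup>2"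
      by (rule tendsto_upperbound) simp
    moreover have "(1 / r + C * r\<^sup>2)\<^sup>2 = 1 / r\<^sup>2 + 2 * C * r + C\<^sup>2 * r^4"
      using r by (simp add: power2_eq_square field_simps eval_nat_numeral)
    ultimately show ?thesis by (simp add: algebra_simps)
  qed
  have "((\<lambda>r. 1 + ?b * r\<^sup>2 + 2 * C * r + C\<^sup>2 * r^4) \<longlongrightarrow> 1 + ?b * 0\<^sup>2 + 2 * C * 0 + C\<^sup>2 * 0^4) (at_right 0)"
    by (intro tendsto_intros)
  moreover have "\<forall>\<^sub>F r in at_right 0. ?b + \<delta>\<^sup>2 \<le> 1 + ?b * r\<^sup>2 + 2 * C * r + C\<^sup>2 * r^4"
  proof -
    have "((\<lambda>r. cmod (deriv n 0) * r\<^sup>2) \<longlongrightarrow> cmod (deriv n 0) * 0\<^sup>2) (at_right 0)"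
      by (intro tendsto_intros)
    then have "\<forall>\<^sub>F r in at_right 0. cmod (deriv n 0) * r\<^sup>2 < 1/2"
      by (rule order_tendstoD) simp
    moreover have "\<forall>\<^sub>F r in at_right (0::real). 0 < r \<and> r < 1/2"
      unfolding eventually_at_right_field by (intro exI[of _ "1/2"]) auto
    ultimately show ?thesis by eventually_elim (rule 2; simp)
  qed
  ultimately have "?b + \<delta>\<^sup>2 \<le> 1 + ?b * 0\<^sup>2 + 2 * C * 0 + C\<^sup>2 * 0^4"
    by (rule tendsto_lowerbound) simp
  then show ?thesis by simp
qed

section \<open>A gap in Bieberbach's inequality for functions of bounded turning\<close>

text \<open>
  Bieberbach's argument: if \<open>F \<zeta> = \<zeta> + a2 * \<zeta>\<^sup>2 + ...\<close> is injective, so is \<open>1 / sqrt (F (z\<^sup>2)) = 1 / z - (a2 / 2) * z + ...\<close>,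
  and the area theorem bounds \<open>a2 / 2\<close>, that is, a quarter of the second derivative. The disc consists of
  points \<open>x\<close> for which \<open>1 / x\<^sup>2\<close> is not a value of \<open>F\<close>; the product form also admits \<open>x = 0\<close>.
\<close>
lemma second_coefficient_omitted_disc:
  fixes F :: "complex \<Rightarrow> complex"
  assumes F: "F holomorphic_on ball 0 1" "inj_on F (ball 0 1)" "F 0 = 0" "deriv F 0 = 1"
    and om: "\<And>x \<zeta>. x \<in> ball x0 \<delta> \<Longrightarrow> \<zeta> \<in> ball 0 1 \<Longrightarrow> F \<zeta> * x\<^sup>2 \<noteq> 1" and \<delta>: "\<delta> \<ge> 0"
  shows "(cmod (deriv (deriv F) 0) / 4)\<^sup>2 + \<delta>\<^sup>2 \<le> 1"
proof -
  obtain \<phi> where \<phi>: "\<phi> holomorphic_on ball 0 1" "\<And>z. cmod z < 1 \<Longrightarrow> F z = z * \<phi> z" "deriv F 0 = \<phi> 0"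
    using Schwarz3[OF F(1,3)] by metis
  have \<phi>0: "\<phi> 0 = 1" using \<phi>(3) F(4) by simp
  have \<phi>nz: "\<phi> z \<noteq> 0" if "z \<in> ball 0 1" for z
  proof
    assume "\<phi> z = 0"
    then have "F z = F 0" using \<phi>(2)[of z] that F(3) by simp
    then have "z = 0" using inj_onD[OF F(2)] that by simp
    then show False using \<open>\<phi> z = 0\<close> \<phi>0 by simp
  qed
  have d\<phi>: "(\<phi> has_field_derivative deriv \<phi> z) (at z)" if "z \<in> ball 0 1" for z
    by (rule holomorphic_derivI[OF \<phi>(1) _ that]) simp
  have F2: "deriv (deriv F) 0 = 2 * deriv \<phi> 0"
  proof -
    have "deriv F z = \<phi> z + z * deriv \<phi> z" if z: "z \<in> ball 0 1" for z
    proof -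
      have "((\<lambda>z. z * \<phi> z) has_field_derivative \<phi> z + z * deriv \<phi> z) (at z)"
        using d\<phi>[OF z] by (auto intro!: derivative_eq_intros)
      then have "(F has_field_derivative \<phi> z + z * deriv \<phi> z) (at z)"
        by (rule has_field_derivative_transform_within_open[OF _ open_ball z]) (simp add: \<phi>(2))
      then show ?thesis by (rule DERIV_imp_deriv)
    qed
    moreover have "((\<lambda>z. \<phi> z + z * deriv \<phi> z) has_field_derivative 2 * deriv \<phi> 0) (at 0)"
    proof -
      have "(deriv \<phi> has_field_derivative deriv (deriv \<phi>) 0) (at 0)"
        by (rule holomorphic_derivI[OF holomorphic_deriv[OF \<phi>(1)]]) auto
      then show ?thesis using d\<phi>[of 0] by (auto intro!: derivative_eq_intros)
    qed
    ultimately have "(deriv F has_field_derivative 2 * deriv \<phi> 0) (at 0)"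
      using has_field_derivative_transform_within_open[of "\<lambda>z. \<phi> z + z * deriv \<phi> z" _ 0 "ball 0 1" "deriv F"]
      by simp
    then show ?thesis by (rule DERIV_imp_deriv)
  qed
  have "(\<lambda>z. 1 / \<phi> z) holomorphic_on ball 0 1"
    by (intro holomorphic_on_divide \<phi> holomorphic_on_const \<phi>nz)
  then obtain m' where m': "m' holomorphic_on ball 0 1" "\<And>z. z \<in> ball 0 1 \<Longrightarrow> 1 / \<phi> z = m' z ^ 2"
    using contractible_imp_holomorphic_sqrt[of "\<lambda>z. 1 / \<phi> z" "ball 0 1"] \<phi>nz
    by (metis convex_ball convex_imp_contractible divide_eq_0_iff zero_neq_one)
  \<comment> \<open>The factor \<open>m' 0\<close> is 1 or -1 and selects the branch with \<open>m 0 = 1\<close>.\<close>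
  define m where "m = (\<lambda>z. m' 0 * m' z)"
  have m0: "(m' 0)\<^sup>2 = 1" using m'(2)[of 0] \<phi>0 by simp
  have m: "m holomorphic_on ball 0 1" unfolding m_def by (intro holomorphic_intros m')
  have msq: "m z ^ 2 * \<phi> z = 1" if "z \<in> ball 0 1" for z
    using m'(2)[OF that] \<phi>nz[OF that] m0 by (simp add: m_def power_mult_distrib field_simps)
  have m1: "m 0 = 1" using m0 by (simp add: m_def power2_eq_square)
  have dm: "(m has_field_derivative deriv m 0) (at 0)"
    by (rule holomorphic_derivI[OF m]) auto
  have m'0: "deriv m 0 = - deriv \<phi> 0 / 2"
  proof -
    have "((\<lambda>z. m z ^ 2 * \<phi> z) has_field_derivative 2 * deriv m 0 + deriv \<phi> 0) (at 0)"
      using dm d\<phi>[of 0] by (auto intro!: derivative_eq_intros simp: m1 \<phi>0)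
    moreover have "((\<lambda>z. m z ^ 2 * \<phi> z) has_field_derivative 0) (at 0)"
      using has_field_derivative_transform_within_open[of "\<lambda>z. 1" 0 0 "ball 0 1" "\<lambda>z. m z ^ 2 * \<phi> z"] msq
      by simp
    ultimately have "2 * deriv m 0 + deriv \<phi> 0 = 0" by (rule DERIV_unique)
    then show ?thesis by (simp add: add_eq_0_iff field_simps)
  qed
  obtain k where k: "k holomorphic_on ball 0 1" "\<And>z. cmod z < 1 \<Longrightarrow> m z - 1 = z * k z"
      "deriv (\<lambda>z. m z - 1) 0 = k 0"
    by (rule Schwarz3[of "\<lambda>z. m z - 1" 1]) (auto intro!: holomorphic_intros m simp: m1)
  have "((\<lambda>z. m z - 1) has_field_derivative deriv m 0) (at 0)"
    using dm by (auto intro!: derivative_eq_intros)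
  then have k0: "k 0 = deriv m 0" using k(3) DERIV_imp_deriv by metis
  have sq: "z\<^sup>2 \<in> ball 0 1" if "z \<in> ball 0 1" for z :: complex
    using that by (simp add: norm_power power_less_one_iff abs_square_less_1)
  \<comment> \<open>\<open>1 / z + n z\<close> is the odd branch of \<open>1 / sqrt (F (z\<^sup>2))\<close>.\<close>
  define n where "n = (\<lambda>z. z * k (z\<^sup>2))"
  have "(\<lambda>z. k (z\<^sup>2)) holomorphic_on ball 0 1"
    by (rule holomorphic_on_compose_gen[OF _ k(1), unfolded o_def]) (use sq in \<open>auto intro!: holomorphic_intros\<close>)
  then have n: "n holomorphic_on ball 0 1"
    unfolding n_def by (intro holomorphic_on_mult holomorphic_on_ident)
  have dn: "deriv n 0 = k 0"
  proof -
    have "((\<lambda>z. k (z\<^sup>2)) has_field_derivative deriv (\<lambda>z. k (z\<^sup>2)) 0) (at 0)"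
      by (rule holomorphic_derivI[OF \<open>(\<lambda>z. k (z\<^sup>2)) holomorphic_on ball 0 1\<close>]) auto
    then have "(n has_field_derivative k 0) (at 0)"
      unfolding n_def by (auto intro!: derivative_eq_intros)
    then show ?thesis by (rule DERIV_imp_deriv)
  qed
  have G: "1 / z + n z = m (z\<^sup>2) / z" if "z \<in> ball 0 1 - {0}" for z
  proof -
    have "m (z\<^sup>2) = 1 + z\<^sup>2 * k (z\<^sup>2)" using k(2)[of "z\<^sup>2"] sq[of z] that by (simp add: algebra_simps)
    then show ?thesis using that by (simp add: n_def field_simps power2_eq_square)
  qed
  have G2: "F (z\<^sup>2) * (1 / z + n z)\<^sup>2 = 1" if z: "z \<in> ball 0 1 - {0}" for z
  proof -
    have "F (z\<^sup>2) = z\<^sup>2 * \<phi> (z\<^sup>2)" using \<phi>(2)[of "z\<^sup>2"] sq[of z] z by simp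
    moreover have "m (z\<^sup>2) ^ 2 * \<phi> (z\<^sup>2) = 1" using msq sq z by blast
    ultimately show ?thesis unfolding G[OF z] using z by (simp add: field_simps)
  qed
  have inj: "inj_on (\<lambda>z. 1 / z + n z) (ball 0 1 - {0})"
  proof (rule inj_onI)
    fix x y :: complex
    assume x: "x \<in> ball 0 1 - {0}" and y: "y \<in> ball 0 1 - {0}" and eq: "1 / x + n x = 1 / y + n y"
    have nz: "1 / y + n y \<noteq> 0" using G2[OF y] by (metis mult_zero_right zero_neq_one zero_power2)
    have "F (x\<^sup>2) * (1 / y + n y)\<^sup>2 = F (y\<^sup>2) * (1 / y + n y)\<^sup>2"
      using G2[OF x] G2[OF y] eq by simp
    then have "F (x\<^sup>2) = F (y\<^sup>2)" using nz by simp
    then have "x\<^sup>2 = y\<^sup>2" using inj_onD[OF F(2)] sq x y by blast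
    then consider "x = y" | "x = - y" by (auto simp: power2_eq_iff)
    then show "x = y"
    proof cases
      case 2
      then have "1 / x + n x = - (1 / y + n y)" by (simp add: n_def)
      then have "1 / y + n y = - (1 / y + n y)" by (rule trans[OF eq[symmetric]])
      moreover have "w = 0" if "w = - w" for w :: complex
        using that by (simp add: complex_eq_iff)
      ultimately have "1 / y + n y = 0" by blast
      then show ?thesis using nz by blast
    qed
  qed
  have "ball x0 \<delta> \<inter> (\<lambda>z. 1 / z + n z) ` (ball 0 1 - {0}) = {}"
    using G2 om sq by fastforce
  from area_theorem_with_omitted_disc[OF n inj this \<delta>]
  show ?thesis unfolding dn k0 m'0 F2 by (simp add: norm_mult norm_divide power_divide)
qed

text \<open>
  The image of the disc is joined up by paths whose diameter, rather than length, is controlled by the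
  distance of the end points. The path is given in the disc, so that the notion applies to an
  injective \<open>F\<close> without mentioning its inverse.
\<close>
definition bounded_turning :: "real \<Rightarrow> (complex \<Rightarrow> complex) \<Rightarrow> bool" where
  "bounded_turning M F \<longleftrightarrow>
     (\<forall>z1\<in>ball 0 1. \<forall>z2\<in>ball 0 1. \<exists>\<beta>. path \<beta> \<and> path_image \<beta> \<subseteq> ball 0 1 \<and>
        pathstart \<beta> = z1 \<and> pathfinish \<beta> = z2 \<and>
        (\<forall>t\<in>{0..1}. cmod (F (\<beta> t) - F z1) \<le> M * cmod (F z1 - F z2)))"

text \<open>
  If \<open>S z2\<close> were very close to \<open>- S z1\<close>, then \<open>F z1\<close> and \<open>F z2\<close> would be close and joined by a path of small diameter in
  the image. Along it \<open>S\<^sup>2\<close> stays so near to \<open>(S z1)\<^sup>2\<close> that it cannot go around 0, so \<open>S\<close> keeps its branch and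
  ends near \<open>S z1\<close> instead.
\<close>
lemma sqrt_values_not_antipodal:
  fixes F S :: "complex \<Rightarrow> complex"
  assumes bt: "bounded_turning M F" and M: "M \<ge> 1"
    and S: "continuous_on (ball 0 1) S" and p: "p \<noteq> 0"
    and FS: "\<And>z. z \<in> ball 0 1 \<Longrightarrow> F z = p * (1 - (S z)\<^sup>2)"
    and z: "z1 \<in> ball 0 1" "z2 \<in> ball 0 1"
  shows "1 / (3 * M) * cmod (S z1) \<le> cmod (S z1 + S z2)"
proof (rule ccontr)
  define k where "k = 1 / (3 * M)"
  have k: "0 < k" "k \<le> 1/3" "M * k = 1/3" using M by (auto simp: k_def field_simps)
  assume "\<not> ?thesis"
  then have lt: "cmod (S z1 + S z2) < k * cmod (S z1)" by (simp add: k_def)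
  then have s1: "S z1 \<noteq> 0" by auto
  obtain \<beta> where \<beta>: "path \<beta>" "path_image \<beta> \<subseteq> ball 0 1" "pathstart \<beta> = z1" "pathfinish \<beta> = z2"
     "\<And>t. t \<in> {0..1} \<Longrightarrow> cmod (F (\<beta> t) - F z1) \<le> M * cmod (F z1 - F z2)"
    using bt z unfolding bounded_turning_def by meson
  have \<beta>in: "\<beta> t \<in> ball 0 1" if "t \<in> {0..1}" for t
    using \<beta>(2) that unfolding path_image_def by (meson image_subset_iff)
  define q where "q = (\<lambda>t. S (\<beta> t) / S z1)"
  have close: "cmod ((q t)\<^sup>2 - 1) < 1" if t: "t \<in> {0..1}" for t
  proof -
    have "cmod (S z1 - S z2) \<le> cmod (2 * S z1) + cmod (S z1 + S z2)"
      using norm_triangle_ineq4[of "2 * S z1" "S z1 + S z2"] by simp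
    also have "\<dots> \<le> (7/3) * cmod (S z1)"
      using lt mult_right_mono[OF k(2), of "cmod (S z1)"] by (simp add: norm_mult)
    finally have d: "cmod (S z1 - S z2) \<le> (7/3) * cmod (S z1)" .
    have "F (\<beta> t) - F z1 = - p * ((S (\<beta> t))\<^sup>2 - (S z1)\<^sup>2)"
      using FS[OF \<beta>in[OF t]] FS[OF z(1)] by (simp add: algebra_simps)
    moreover have "F z1 - F z2 = - p * ((S z1 - S z2) * (S z1 + S z2))"
      using FS[OF z(1)] FS[OF z(2)] by (simp add: algebra_simps power2_eq_square)
    ultimately have "cmod p * cmod ((S (\<beta> t))\<^sup>2 - (S z1)\<^sup>2)
        \<le> M * (cmod p * (cmod (S z1 - S z2) * cmod (S z1 + S z2)))"
      using \<beta>(5)[OF t] by (simp add: norm_mult)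
    then have "cmod p * cmod ((S (\<beta> t))\<^sup>2 - (S z1)\<^sup>2)
        \<le> cmod p * (M * (cmod (S z1 - S z2) * cmod (S z1 + S z2)))"
      by (simp add: mult.left_commute)
    then have "cmod ((S (\<beta> t))\<^sup>2 - (S z1)\<^sup>2) \<le> M * (cmod (S z1 - S z2) * cmod (S z1 + S z2))"
      using p by simp
    also have "\<dots> \<le> M * ((7/3 * cmod (S z1)) * (k * cmod (S z1)))"
      using M d lt by (intro mult_left_mono mult_mono) auto
    also have "\<dots> = 7/9 * (cmod (S z1))\<^sup>2"
      using k(3) by (simp add: power2_eq_square algebra_simps)
    also have "\<dots> < (cmod (S z1))\<^sup>2" using s1 by simp
    finally have "cmod ((S (\<beta> t))\<^sup>2 - (S z1)\<^sup>2) < (cmod (S z1))\<^sup>2" .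
    moreover have "(q t)\<^sup>2 - 1 = ((S (\<beta> t))\<^sup>2 - (S z1)\<^sup>2) / (S z1)\<^sup>2"
      using s1 by (simp add: q_def power_divide diff_divide_distrib)
    ultimately show ?thesis
      using s1 by (simp add: norm_divide norm_power)
  qed
  \<comment> \<open>So \<open>(q t)\<^sup>2\<close> stays in the right half-plane and \<open>q\<close> cannot pass from one branch to the other.\<close>
  have nz: "Re (q t) \<noteq> 0" if t: "t \<in> {0..1}" for t
  proof
    assume "Re (q t) = 0"
    then have "Re ((q t)\<^sup>2) \<le> 0" by (simp add: power2_eq_square)
    then have "Re ((q t)\<^sup>2 - 1) \<le> -1" by simp
    moreover have "\<bar>Re ((q t)\<^sup>2 - 1)\<bar> < 1" using close[OF t] abs_Re_le_cmod order_le_less_trans by blast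
    ultimately show False by linarith
  qed
  have "continuous_on {0..1} \<beta>" using \<beta>(1) by (simp add: path_def)
  then have "continuous_on {0..1} (\<lambda>t. S (\<beta> t))"
    by (rule continuous_on_compose2[OF S]) (use \<beta>in in blast)
  then have cont: "continuous_on {0..1} (\<lambda>t. Re (q t))"
    unfolding q_def using s1 by (intro continuous_intros) auto
  have "q 0 = 1" "q 1 = S z2 / S z1"
    using s1 \<beta>(3,4) by (simp_all add: q_def pathstart_def pathfinish_def)
  have "Re (q 1) > 0"
  proof (rule ccontr)
    assume "\<not> Re (q 1) > 0"
    then have "\<exists>t\<ge>0. t \<le> 1 \<and> Re (q t) = 0"
      by (intro IVT2' cont) (use \<open>q 0 = 1\<close> in auto)
    then show False using nz by auto
  qed
  then have "1 < Re (1 + q 1)" by simp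
  also have "\<dots> \<le> cmod (1 + q 1)" by (rule complex_Re_le_cmod)
  also have "1 + q 1 = (S z1 + S z2) / S z1" using s1 by (simp add: \<open>q 1 = _\<close> field_simps)
  finally have "cmod (S z1) < cmod (S z1 + S z2)" using s1 by (simp add: norm_divide field_simps)
  also have "\<dots> < k * cmod (S z1)" by (rule lt)
  also have "\<dots> \<le> 1 * cmod (S z1)" using k by (intro mult_right_mono) auto
  finally show False by simp
qed

text \<open>
  Choose \<open>u\<close> on the unit circle at equal distance \<open>\<tau>\<close> from \<open>X\<close> and from \<open>-X\<close>. Nearly closest points \<open>s\<close> and \<open>-s'\<close> satisfy
  \<open>cmod (s + s') \<le> 2 * \<tau>\<close> and \<open>cmod s \<ge> 1 - \<tau>\<close> up to small errors, so \<open>k * (1 - \<tau>) \<le> 2 * \<tau>\<close> and \<open>\<tau>\<close> is at least \<open>k / 3\<close>.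
\<close>
lemma antipodal_discs_outside:
  fixes X :: "complex set"
  assumes X: "X \<noteq> {}" and k: "0 < k" "k \<le> 1"
    and sep: "\<And>s s'. s \<in> X \<Longrightarrow> s' \<in> X \<Longrightarrow> k * cmod s \<le> cmod (s + s')"
  obtains u where "cmod u = 1" "ball u (k / 3) \<inter> X = {}" "ball (- u) (k / 3) \<inter> X = {}"
proof -
  \<comment> \<open>\<open>infdist (- u) X\<close> is the distance from \<open>u\<close> to \<open>-X\<close>; \<open>d\<close> changes sign on the half circle.\<close>
  define d where "d = (\<lambda>t. infdist (cis t) X - infdist (- cis t) X)"
  have cont: "continuous_on {0..pi} d"
    unfolding d_def by (intro continuous_intros)
  have "d pi = - d 0" by (simp add: d_def)
  have "\<exists>t\<ge>0. t \<le> pi \<and> d t = 0"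
  proof (cases "d 0 \<le> 0")
    case True then show ?thesis using IVT'[of d 0 0 pi] cont \<open>d pi = - d 0\<close> by auto
  next
    case False then show ?thesis using IVT2'[of d pi 0 0] cont \<open>d pi = - d 0\<close> by auto
  qed
  then obtain t where "d t = 0" by auto
  define u where "u = cis t"
  define \<tau> where "\<tau> = infdist u X"
  have u: "cmod u = 1" "infdist (- u) X = \<tau>" using \<open>d t = 0\<close> by (auto simp: u_def \<tau>_def d_def)
  have near: "\<exists>s\<in>X. dist v s < c" if "infdist v X < c" for v c
  proof (rule ccontr)
    assume "\<not> ?thesis"
    then have "c \<le> (INF s\<in>X. dist v s)"
      by (intro cINF_greatest X) (auto simp: not_less)
    then show False using that X by (simp add: infdist_notempty)
  qed
  have \<tau>: "k / 3 \<le> \<tau>"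
  proof (rule ccontr)
    assume "\<not> k / 3 \<le> \<tau>"
    then have "infdist u X < k / 3" "infdist (- u) X < k / 3" using u by (auto simp: \<tau>_def)
    then obtain s s' where s: "s \<in> X" "dist u s < k / 3" "s' \<in> X" "dist (- u) s' < k / 3"
      using near by meson
    have "cmod (s + s') \<le> dist u s + dist (-u) s'"
      using norm_triangle_ineq[of "s - u" "s' + u"] by (simp add: dist_norm norm_minus_commute add.commute)
    then have 1: "cmod (s + s') < 2 * k / 3" using s by simp
    have "cmod s \<ge> 1 - k / 3"
      using norm_triangle_ineq2[of u s] s(2) u by (simp add: dist_norm)
    then have "k * (1 - k / 3) \<le> k * cmod s" using k by (intro mult_left_mono) auto
    then have "k * (1 - k / 3) < 2 * k / 3" using sep[OF s(1,3)] 1 by linarith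
    moreover have "k * (2/3) \<le> k * (1 - k/3)" using k by (intro mult_left_mono) auto
    ultimately show False by simp
  qed
  have "ball v (k / 3) \<inter> X = {}" if "infdist v X = \<tau>" for v
  proof -
    have "k / 3 \<le> dist v x" if "x \<in> X" for x
      using infdist_le[OF that, of v] \<tau> \<open>infdist v X = \<tau>\<close> by simp
    then show ?thesis by (meson disjoint_iff mem_ball not_less)
  qed
  from this[of u] this[of "-u"] show ?thesis using that[of u] u by (simp add: \<tau>_def)
qed

text \<open>
  The image of the disc of radius \<open>t\<close> about \<open>u\<close> under \<open>v \<mapsto> p * (1 - v\<^sup>2)\<close> contains the disc of radius \<open>cmod p * t\<close> about
  \<open>p * (1 - u\<^sup>2)\<close>. The points \<open>x\<close> with \<open>1 / x\<^sup>2\<close> in the latter contain a disc whose radius scales like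
  \<open>1 / sqrt (cmod p)\<close>, so the upper bound on \<open>p\<close> alone gives a uniform radius. The relative perturbation \<open>t / 60\<close>
  of \<open>x0\<close> is harmless, and \<open>cmod x0 \<ge> 1 / 3\<close>, whence \<open>t / 180\<close>.
\<close>
lemma disc_of_reciprocal_roots:
  fixes u p :: complex
  assumes u: "cmod u = 1" and t: "0 < t" "t \<le> 1" and p: "p \<noteq> 0" "cmod p \<le> 2"
  shows "\<exists>x0. \<forall>x\<in>ball x0 (t / 180). \<forall>s. p * (1 - s\<^sup>2) * x\<^sup>2 = 1 \<longrightarrow>
      s \<in> ball u t \<or> s \<in> ball (- u) t"
proof -
  define a where "a = 1 - u\<^sup>2"
  \<comment> \<open>Moving away from 0 by \<open>t / 2\<close> makes \<open>a'\<close> nonzero (it is needed as a reciprocal) and still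
    leaves the disc of radius \<open>t / 2\<close> about \<open>a'\<close> inside the disc of radius \<open>t\<close> about \<open>a\<close>.\<close>
  define a' where "a' = a + (if a = 0 then 1 else sgn a) * of_real (t / 2)"
  have a: "cmod a \<le> 2"
    using norm_triangle_ineq4[of 1 "u\<^sup>2"] u by (simp add: a_def norm_power)
  have aa': "cmod (a' - a) = t / 2"
    using t by (simp add: a'_def norm_mult norm_sgn)
  have a'up: "cmod a' \<le> 3" using norm_triangle_sub[of a' a] aa' a t by simp
  have a'0: "a' \<noteq> 0"
  proof (cases "a = 0")
    case False
    then have "a' = sgn a * (of_real (cmod a) + of_real (t / 2))"
      by (simp add: a'_def algebra_simps sgn_eq)
    moreover have "cmod a + t / 2 \<noteq> 0" using t norm_ge_zero[of a] by linarith
    ultimately show ?thesis using False by (metis mult_eq_0_iff of_real_add of_real_eq_0_iff sgn_zero_iff)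
  qed (use t in \<open>simp add: a'_def\<close>)
  define x0 where "x0 = 1 / csqrt (p * a')"
  have x0: "x0 \<noteq> 0" "p * a' * x0\<^sup>2 = 1"
    using p a'0 by (auto simp: x0_def power_divide)
  have x0_low: "cmod x0 \<ge> 1 / 3"
  proof -
    have "(3 * cmod x0)\<^sup>2 \<ge> 1\<^sup>2"
    proof -
      have "1 = cmod (p * a' * x0\<^sup>2)" unfolding x0(2) by simp
      also have "\<dots> = (cmod p * cmod a') * (cmod x0)\<^sup>2" by (simp add: norm_mult norm_power)
      also have "\<dots> \<le> (2 * 3) * (cmod x0)\<^sup>2"
        using p a'up by (intro mult_right_mono mult_mono) auto
      also have "\<dots> \<le> (3 * cmod x0)\<^sup>2" by (simp add: power_mult_distrib)
      finally show ?thesis by simp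
    qed
    then have "1 \<le> 3 * cmod x0" by (rule power2_le_imp_le) simp
    then show ?thesis by simp
  qed
  show ?thesis
  proof (intro exI[of _ x0] ballI allI impI)
    fix x s assume x: "x \<in> ball x0 (t / 180)" and eq: "p * (1 - s\<^sup>2) * x\<^sup>2 = 1"
    define \<eta> where "\<eta> = (x - x0) / x0"
    have xe: "x = x0 * (1 + \<eta>)" using x0 by (simp add: \<eta>_def field_simps)
    have "cmod \<eta> = dist x0 x / cmod x0"
      by (simp add: \<eta>_def norm_divide dist_norm norm_minus_commute)
    also have "\<dots> \<le> dist x0 x / (1/3)"
      using x0_low by (intro divide_left_mono) auto
    also have "\<dots> < t / 60" using x by simp
    finally have \<eta>: "cmod \<eta> < t / 60" .
    have e1: "cmod (1 + \<eta>) \<ge> 1/2"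
      using norm_triangle_ineq2[of 1 "-\<eta>"] \<eta> t by simp
    then have e0: "1 + \<eta> \<noteq> 0" by auto
    have "(1 - s\<^sup>2) * (1 + \<eta>)\<^sup>2 * (p * x0\<^sup>2) = a' * (p * x0\<^sup>2)"
      using eq x0(2) unfolding xe by (simp add: power_mult_distrib mult_ac)
    then have a's: "(1 - s\<^sup>2) * (1 + \<eta>)\<^sup>2 = a'" using p x0 by simp
    have "(1 - s\<^sup>2 - a') * (1 + \<eta>)\<^sup>2 = a' - a' * (1 + \<eta>)\<^sup>2"
      by (simp only: left_diff_distrib[of _ a'] a's)
    also have "\<dots> = - (a' * (\<eta> * (2 + \<eta>)))"
      by (simp add: algebra_simps power2_eq_square)
    finally have 1: "(1 - s\<^sup>2 - a') * (1 + \<eta>)\<^sup>2 = - (a' * (\<eta> * (2 + \<eta>)))" .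
    have "cmod (1 - s\<^sup>2 - a') * (1/4) \<le> cmod (1 - s\<^sup>2 - a') * (cmod (1 + \<eta>))\<^sup>2"
      using power_mono[OF e1, of 2] by (intro mult_left_mono) (auto simp: power_divide)
    also have "\<dots> = cmod a' * (cmod \<eta> * cmod (2 + \<eta>))"
      using arg_cong[OF 1, of cmod] by (simp add: norm_mult norm_power)
    also have "\<dots> \<le> 3 * (cmod \<eta> * (5/2))"
      using a'up norm_triangle_ineq[of 2 \<eta>] \<eta> t by (intro mult_mono) auto
    finally have "cmod (1 - s\<^sup>2 - a') < t / 2" using \<eta> by simp
    then have "cmod ((1 - s\<^sup>2 - a') + (a' - a)) < t"
      using norm_triangle_ineq[of "1 - s\<^sup>2 - a'" "a' - a"] aa' by simp
    then have su: "cmod (s - u) * cmod (s + u) < t"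
    proof -
      have "(1 - s\<^sup>2 - a') + (a' - a) = - ((s - u) * (s + u))"
        by (simp add: a_def algebra_simps power2_eq_square)
      then show ?thesis using \<open>cmod (_ + _) < t\<close> by (simp add: norm_mult)
    qed
    show "s \<in> ball u t \<or> s \<in> ball (- u) t"
    proof (rule ccontr)
      assume "\<not> ?thesis"
      then have ge: "cmod (s - u) \<ge> t" "cmod (s + u) \<ge> t"
        by (auto simp: dist_norm norm_minus_commute add.commute not_less)
      have "2 = cmod ((s + u) - (s - u))" using u by (simp add: norm_mult)
      also have "\<dots> \<le> cmod (s + u) + cmod (s - u)" by (rule norm_triangle_ineq4)
      finally consider "cmod (s + u) \<ge> 1" | "cmod (s - u) \<ge> 1" by linarith
      then have "t * 1 \<le> cmod (s - u) * cmod (s + u)"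
      proof cases
        case 1 then show ?thesis using ge t by (intro mult_mono) auto
      next
        case 2
        then have "1 * t \<le> cmod (s - u) * cmod (s + u)" using ge t by (intro mult_mono) auto
        then show ?thesis by simp
      qed
      then show False using su by simp
    qed
  qed
qed

lemma omitted_value:
  fixes F :: "complex \<Rightarrow> complex"
  assumes F: "F holomorphic_on ball 0 1" "inj_on F (ball 0 1)" "F 0 = 0" "deriv F 0 = 1"
  obtains p where "p \<notin> F ` ball 0 1" "p \<noteq> 0" "cmod p \<le> 2"
proof -
  have "\<exists>p. cmod p < 2 \<and> p \<notin> F ` ball 0 1"
  proof (rule ccontr)
    assume "\<not> ?thesis"
    \<comment> \<open>Otherwise \<open>w \<mapsto> H (2 * w)\<close>, with \<open>H\<close> the inverse of \<open>F\<close>, is a self-map of the disc with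
      derivative 2 at its fixed point 0.\<close>
    then have sub: "ball 0 2 \<subseteq> F ` ball 0 1" by auto
    obtain H where H: "H holomorphic_on (F ` ball 0 1)"
        "\<And>z. z \<in> ball 0 1 \<Longrightarrow> deriv F z * deriv H (F z) = 1"
        "\<And>z. z \<in> ball 0 1 \<Longrightarrow> H (F z) = z"
      using holomorphic_has_inverse[OF F(1) open_ball F(2)] by metis
    define h where "h = (\<lambda>w. H (2 * w))"
    have h: "h holomorphic_on ball 0 1"
      unfolding h_def
      by (rule holomorphic_on_compose_gen[OF _ H(1), unfolded o_def])
         (use sub in \<open>auto intro!: holomorphic_intros simp: norm_mult subset_iff\<close>)
    have h0: "h 0 = 0" using H(3)[of 0] F(3) by (simp add: h_def)
    have hb: "cmod (h z) < 1" if "cmod z < 1" for z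
    proof -
      have "2 * z \<in> F ` ball 0 1" using sub that by (auto simp: norm_mult subset_iff)
      then obtain y where "y \<in> ball 0 1" "2 * z = F y" by blast
      then show ?thesis using H(3)[of y] by (simp add: h_def)
    qed
    have "(H has_field_derivative deriv H 0) (at 0)"
    proof (rule holomorphic_derivI[OF H(1)])
      show "open (F ` ball 0 1)" by (rule open_mapping_thm3[OF F(1) open_ball F(2)])
      show "0 \<in> F ` ball 0 1" using sub by auto
    qed
    then have "(h has_field_derivative deriv H 0 * 2) (at 0)"
      unfolding h_def by (intro DERIV_chain2[where f=H]) (auto intro!: derivative_eq_intros)
    moreover have "deriv H 0 = 1" using H(2)[of 0] F(3,4) by simp
    ultimately have "deriv h 0 = 2" using DERIV_imp_deriv by fastforce
    then show False using Schwarz_Lemma(2)[OF h h0 hb, of 0] by simp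
  qed
  then obtain p where p: "cmod p < 2" "p \<notin> F ` ball 0 1" by blast
  moreover have "0 \<in> F ` ball 0 1" using F(3) by (auto intro!: image_eqI[of _ _ 0])
  ultimately show ?thesis using that[of p] by auto
qed

text \<open>
  The radius collects the losses of the three steps: separation \<open>k = 1 / (3 * M)\<close> of the square root from
  its negative, discs of radius \<open>k / 3\<close>, and the factor \<open>1 / 180\<close> for passing to reciprocal roots.
\<close>
lemma second_coefficient_bounded_turning:
  fixes F :: "complex \<Rightarrow> complex"
  assumes F: "F holomorphic_on ball 0 1" "inj_on F (ball 0 1)" "F 0 = 0" "deriv F 0 = 1"
    and bt: "bounded_turning M F" and M: "M \<ge> 1"
  shows "(cmod (deriv (deriv F) 0) / 4)\<^sup>2 + (1 / (1620 * M))\<^sup>2 \<le> 1"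
proof -
  obtain p where p: "p \<notin> F ` ball 0 1" "p \<noteq> 0" "cmod p \<le> 2"
    by (rule omitted_value[OF F]) (rule that)
  have "(\<lambda>z. 1 - F z / p) holomorphic_on ball 0 1"
    using p by (intro holomorphic_intros F) auto
  moreover have "1 - F z / p \<noteq> 0" if "z \<in> ball 0 1" for z
    using p that by (auto simp: field_simps)
  ultimately obtain S where S: "S holomorphic_on ball 0 1" "\<And>z. z \<in> ball 0 1 \<Longrightarrow> 1 - F z / p = (S z)\<^sup>2"
    using contractible_imp_holomorphic_sqrt[of "\<lambda>z. 1 - F z / p" "ball 0 1"]
    by (metis convex_ball convex_imp_contractible)
  have FS: "F z = p * (1 - (S z)\<^sup>2)" if "z \<in> ball 0 1" for z
    using S(2)[OF that] p(2) by (simp add: field_simps)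
  define k where "k = 1 / (3 * M)"
  have k: "0 < k" "k \<le> 1" using M by (auto simp: k_def)
  have sep: "k * cmod s \<le> cmod (s + s')" if "s \<in> S ` ball 0 1" "s' \<in> S ` ball 0 1" for s s'
    using sqrt_values_not_antipodal[OF bt M holomorphic_on_imp_continuous_on[OF S(1)] p(2) FS] that
    unfolding k_def by blast
  have ne: "S ` ball 0 1 \<noteq> {}" by simp
  obtain u where u: "cmod u = 1" "ball u (k / 3) \<inter> S ` ball 0 1 = {}" "ball (- u) (k / 3) \<inter> S ` ball 0 1 = {}"
    by (rule antipodal_discs_outside[OF ne k], erule (1) sep, rule that)
  have k3: "0 < k / 3" "k / 3 \<le> 1" using k by auto
  obtain x0 where x0: "\<forall>x\<in>ball x0 (k / 3 / 180). \<forall>s. p * (1 - s\<^sup>2) * x\<^sup>2 = 1 \<longrightarrow>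
      s \<in> ball u (k / 3) \<or> s \<in> ball (- u) (k / 3)"
    using disc_of_reciprocal_roots[OF u(1) k3 p(2,3)] by (rule exE)
  have "F \<zeta> * x\<^sup>2 \<noteq> 1" if x: "x \<in> ball x0 (k / 3 / 180)" "\<zeta> \<in> ball 0 1" for x \<zeta>
  proof
    assume "F \<zeta> * x\<^sup>2 = 1"
    then have "S \<zeta> \<in> ball u (k / 3) \<or> S \<zeta> \<in> ball (- u) (k / 3)"
      using x0[rule_format, OF x(1), of "S \<zeta>"] FS[OF x(2)] by simp
    then show False using u x(2) by blast
  qed
  from second_coefficient_omitted_disc[OF F this, of x0] k
  show ?thesis by (simp add: k_def)
qed

section \<open>The Koebe transform\<close>

text \<open>
  The second derivative at 0 of the Koebe transform of \<open>h\<close> at \<open>z\<close> is twice the quantity to be bounded, and the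
  transform has the same bounded turning constant, since it differs from \<open>h\<close> by an automorphism of the
  disc before and a similarity after.
\<close>
lemma pre_Schwarzian_bounded_turning:
  fixes h :: "complex \<Rightarrow> complex"
  assumes h: "h holomorphic_on ball 0 1" "inj_on h (ball 0 1)"
    and bt: "bounded_turning M h" and M: "M \<ge> 1" and z: "z \<in> ball 0 1"
  shows "(cmod (of_real ((1 - (cmod z)\<^sup>2) / 2) * (deriv (deriv h) z / deriv h z) - cnj z) / 2)\<^sup>2
          + (1 / (1620 * M))\<^sup>2 \<le> 1"
proof -
  \<comment> \<open>\<open>T\<close> is the automorphism of the disc with \<open>T 0 = z\<close>, and \<open>T'\<close> is its inverse.\<close>
  define T where "T = Moebius_function 0 (- z)"
  define T' where "T' = Moebius_function 0 z"
  have Teq: "T \<zeta> = (\<zeta> + z) / (1 + cnj z * \<zeta>)" for \<zeta>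
    by (simp add: T_def Moebius_function_simple)
  have Tin: "T \<zeta> \<in> ball 0 1" "T' \<zeta> \<in> ball 0 1" if "\<zeta> \<in> ball 0 1" for \<zeta>
    using that z by (auto simp: T_def T'_def Moebius_function_norm_lt_1)
  have TT': "T (T' \<zeta>) = \<zeta>" "T' (T \<zeta>) = \<zeta>" if "\<zeta> \<in> ball 0 1" for \<zeta>
    using that z unfolding T_def T'_def by (auto intro!: Moebius_function_compose)
  have Thol: "T holomorphic_on ball 0 1" and T'hol: "T' holomorphic_on ball 0 1"
    using z by (auto simp: T_def T'_def intro!: Moebius_function_holomorphic)
  define a where "a = 1 - cnj z * z"
  have a: "a = of_real (1 - (cmod z)\<^sup>2)"
    using complex_norm_square[of z] by (simp add: a_def mult.commute)
  have "(cmod z)\<^sup>2 < 1" using z by (simp add: abs_square_less_1)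
  then have a0: "a \<noteq> 0" unfolding a of_real_eq_0_iff by simp
  have den: "1 + cnj z * \<zeta> \<noteq> 0" if "\<zeta> \<in> ball 0 1" for \<zeta>
  proof
    assume "1 + cnj z * \<zeta> = 0"
    then have "cmod (cnj z * \<zeta>) = 1" by (metis add_eq_0_iff norm_minus_cancel norm_one)
    moreover have "cmod z * cmod \<zeta> < 1 * 1"
      using z that by (intro mult_strict_mono') auto
    ultimately show False by (simp add: norm_mult)
  qed
  have dT: "(T has_field_derivative a / (1 + cnj z * \<zeta>)\<^sup>2) (at \<zeta>)" if "\<zeta> \<in> ball 0 1" for \<zeta>
    unfolding Teq[abs_def] using den[OF that]
    by (auto intro!: derivative_eq_intros simp: a_def field_simps power2_eq_square)
  have h'0: "deriv h z \<noteq> 0"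
    by (rule holomorphic_injective_imp_regular[OF h(1) open_ball h(2) z])
  have dh: "(h has_field_derivative deriv h w) (at w)" if "w \<in> ball 0 1" for w
    by (rule holomorphic_derivI[OF h(1) open_ball that])
  have dh2: "(deriv h has_field_derivative deriv (deriv h) w) (at w)" if "w \<in> ball 0 1" for w
    by (rule holomorphic_derivI[OF holomorphic_deriv[OF h(1) open_ball] open_ball that])
  \<comment> \<open>The Koebe transform of \<open>h\<close> at \<open>z\<close>.\<close>
  define F where "F = (\<lambda>\<zeta>. (h (T \<zeta>) - h z) / (a * deriv h z))"
  have F0: "F 0 = 0" by (simp add: F_def Teq)
  define D where "D = (\<lambda>\<zeta>. deriv h (T \<zeta>) / (deriv h z * (1 + cnj z * \<zeta>)\<^sup>2))"
  have dF: "(F has_field_derivative D \<zeta>) (at \<zeta>)" if \<zeta>: "\<zeta> \<in> ball 0 1" for \<zeta>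
  proof -
    have "((\<lambda>\<zeta>. h (T \<zeta>)) has_field_derivative deriv h (T \<zeta>) * (a / (1 + cnj z * \<zeta>)\<^sup>2)) (at \<zeta>)"
      by (rule DERIV_chain2[OF dh[OF Tin(1)[OF \<zeta>]] dT[OF \<zeta>]])
    from DERIV_cdivide[OF DERIV_diff[OF this DERIV_const], of "h z" "a * deriv h z"]
    show ?thesis using a0 h'0 den[OF \<zeta>] by (simp add: F_def D_def field_simps)
  qed
  have Fhol: "F holomorphic_on ball 0 1"
    unfolding holomorphic_on_open[OF open_ball] using dF by blast
  have F'0: "deriv F 0 = 1"
    using DERIV_imp_deriv[OF dF[of 0]] h'0 by (simp add: D_def Teq)
  have Finj: "inj_on F (ball 0 1)"
  proof (rule inj_onI)
    fix x y :: complex assume xy: "x \<in> ball 0 1" "y \<in> ball 0 1" "F x = F y"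
    then have "h (T x) = h (T y)" using a0 h'0 by (simp add: F_def)
    then have "T x = T y" using inj_onD[OF h(2)] Tin xy by blast
    then show "x = y" using TT'(2) xy by metis
  qed
  have Fbt: "bounded_turning M F"
    unfolding bounded_turning_def
  proof (intro ballI)
    fix x y :: complex assume x: "x \<in> ball 0 1" and y: "y \<in> ball 0 1"
    obtain \<beta> where \<beta>: "path \<beta>" "path_image \<beta> \<subseteq> ball 0 1" "pathstart \<beta> = T x" "pathfinish \<beta> = T y"
       "\<And>t. t \<in> {0..1} \<Longrightarrow> cmod (h (\<beta> t) - h (T x)) \<le> M * cmod (h (T x) - h (T y))"
      using bt Tin(1)[OF x] Tin(1)[OF y] unfolding bounded_turning_def by meson
    have \<beta>in: "\<beta> t \<in> ball 0 1" if "t \<in> {0..1}" for t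
      using \<beta>(2) that unfolding path_image_def by (meson image_subset_iff)
    have Fd: "cmod (F u - F v) = cmod (h (T u) - h (T v)) / cmod (a * deriv h z)" for u v
      by (simp add: F_def norm_divide flip: diff_divide_distrib)
    have "path (T' \<circ> \<beta>)"
      by (rule path_continuous_image[OF \<beta>(1)])
         (rule continuous_on_subset[OF holomorphic_on_imp_continuous_on[OF T'hol] \<beta>(2)])
    moreover have "path_image (T' \<circ> \<beta>) \<subseteq> ball 0 1"
      unfolding path_image_compose using \<beta>(2) Tin(2) by blast
    moreover have "pathstart (T' \<circ> \<beta>) = x" "pathfinish (T' \<circ> \<beta>) = y"
      using \<beta>(3,4) TT'(2) x y by (simp_all add: pathstart_compose pathfinish_compose)
    moreover have "cmod (F ((T' \<circ> \<beta>) t) - F x) \<le> M * cmod (F x - F y)" if t: "t \<in> {0..1}" for t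
      using divide_right_mono[OF \<beta>(5)[OF t], of "cmod (a * deriv h z)"] TT'(1)[OF \<beta>in[OF t]]
      by (simp add: Fd)
    ultimately show "\<exists>\<beta>. path \<beta> \<and> path_image \<beta> \<subseteq> ball 0 1 \<and> pathstart \<beta> = x \<and> pathfinish \<beta> = y \<and>
        (\<forall>t\<in>{0..1}. cmod (F (\<beta> t) - F x) \<le> M * cmod (F x - F y))" by blast
  qed
  define A where "A = of_real ((1 - (cmod z)\<^sup>2) / 2) * (deriv (deriv h) z / deriv h z) - cnj z"
  have "deriv (deriv F) 0 = a * deriv (deriv h) z / deriv h z - 2 * cnj z"
  proof -
    have T0: "T 0 = z" by (simp add: Teq)
    have z0: "(0::complex) \<in> ball 0 1" by simp
    have 1: "((\<lambda>\<zeta>. deriv h (T \<zeta>)) has_field_derivative deriv (deriv h) z * a) (at 0)"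
      using DERIV_chain2[OF dh2[OF Tin(1)[OF z0]] dT[OF z0]] by (simp add: T0)
    have "(D has_field_derivative a * deriv (deriv h) z / deriv h z - 2 * cnj z) (at 0)"
      unfolding D_def using h'0
      by (auto intro!: derivative_eq_intros 1 simp: T0 field_simps power2_eq_square)
    then have "(deriv F has_field_derivative a * deriv (deriv h) z / deriv h z - 2 * cnj z) (at 0)"
      by (rule has_field_derivative_transform_within_open[OF _ open_ball[of 0 1]])
         (use DERIV_imp_deriv[OF dF] in auto)
    then show ?thesis by (rule DERIV_imp_deriv)
  qed
  also have "\<dots> = 2 * A"
    unfolding a A_def by simp
  finally have "cmod (deriv (deriv F) 0) / 4 = cmod A / 2"
    by (simp add: norm_mult)
  then show ?thesis
    using second_coefficient_bounded_turning[OF Fhol Finj F0 F'0 Fbt M]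
    unfolding A_def by simp
qed

section \<open>Harmonic mappings onto linearly connected domains\<close>

text \<open>
  A map that is \<open>K\<close>-Lipschitz with respect to \<open>\<gamma>\<close> at small parameter distances is so along the whole path, once
  distances are replaced by length: sum over a fine partition.
\<close>
lemma dist_along_path_le:
  fixes \<gamma> :: "real \<Rightarrow> 'a::metric_space" and v :: "real \<Rightarrow> 'b::metric_space"
  assumes len: "path_length \<gamma> \<le> ereal l" and K: "K \<ge> 0" and d: "d > 0"
    and lip: "\<And>s t. s \<in> {0..1} \<Longrightarrow> t \<in> {0..1} \<Longrightarrow> \<bar>s - t\<bar> < d \<Longrightarrow> dist (v s) (v t) \<le> K * dist (\<gamma> s) (\<gamma> t)"
    and t: "t \<in> {0..1}"
  shows "dist (v 0) (v t) \<le> K * l"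
proof -
  obtain N :: nat where N: "1 / d < real N" using reals_Archimedean2 by blast
  then have N0: "N > 0" using d by (metis divide_pos_pos less_trans of_nat_0_less_iff zero_less_one)
  define \<tau> where "\<tau> = (\<lambda>i. t * (real i / real N))"
  have \<tau>: "\<tau> i \<in> {0..1}" if "i \<le> N" for i
    using mult_le_one[of t "real i / real N"] that t N0 by (auto simp: \<tau>_def)
  have "mono_on {..N} \<tau>"
    using t by (auto intro!: mono_onI mult_left_mono divide_right_mono simp: \<tau>_def)
  then have "(N, \<tau>) \<in> {(n, t). mono_on {..n} t \<and> t ` {..n} \<subseteq> {0..1}}"
    using \<tau> by auto
  then have "ereal (\<Sum>i<N. dist (\<gamma> (\<tau> i)) (\<gamma> (\<tau> (Suc i)))) \<le> path_length \<gamma>"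
    unfolding path_length_def by (rule SUP_upper2) simp
  then have len': "(\<Sum>i<N. dist (\<gamma> (\<tau> i)) (\<gamma> (\<tau> (Suc i)))) \<le> l"
    using len by (meson ereal_less_eq(3) order_trans)
  have step: "dist (v (\<tau> i)) (v (\<tau> (Suc i))) \<le> K * dist (\<gamma> (\<tau> i)) (\<gamma> (\<tau> (Suc i)))" if "i < N" for i
  proof (rule lip)
    have "\<bar>\<tau> i - \<tau> (Suc i)\<bar> = t / N"
      using t N0 by (simp add: \<tau>_def field_simps)
    also have "\<dots> \<le> 1 / N" using t by (intro divide_right_mono) auto
    also have "\<dots> < d" using N d N0 by (simp add: field_simps)
    finally show "\<bar>\<tau> i - \<tau> (Suc i)\<bar> < d" .
  qed (use \<tau> that in auto)
  have "dist (v (\<tau> 0)) (v (\<tau> n)) \<le> (\<Sum>i<n. dist (v (\<tau> i)) (v (\<tau> (Suc i))))" for n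
  proof (induction n)
    case (Suc n)
    then show ?case using dist_triangle[of "v (\<tau> 0)" "v (\<tau> (Suc n))" "v (\<tau> n)"] by simp
  qed simp
  then have "dist (v (\<tau> 0)) (v (\<tau> N)) \<le> (\<Sum>i<N. dist (v (\<tau> i)) (v (\<tau> (Suc i))))" .
  also have "\<dots> \<le> (\<Sum>i<N. K * dist (\<gamma> (\<tau> i)) (\<gamma> (\<tau> (Suc i))))"
    by (intro sum_mono step) auto
  also have "\<dots> = K * (\<Sum>i<N. dist (\<gamma> (\<tau> i)) (\<gamma> (\<tau> (Suc i))))"
    by (simp add: sum_distrib_left)
  also have "\<dots> \<le> K * l" by (rule mult_left_mono[OF len' K])
  finally show ?thesis using N0 by (simp add: \<tau>_def)
qed

text \<open>
  Near \<open>z0\<close> the functions \<open>h\<close> and \<open>g\<close> are almost linear, so locally the quotient of increments of \<open>g\<close> and of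
  \<open>f = h + cnj g\<close> is close to at most \<open>c / (1 - c)\<close>, which is less than \<open>2 * c\<close>.
\<close>
lemma coanalytic_part_locally_dominated:
  fixes h g :: "complex \<Rightarrow> complex"
  assumes U: "open U" "z0 \<in> U" and h: "h holomorphic_on U" and g: "g holomorphic_on U"
    and h'0: "deriv h z0 \<noteq> 0" and dil: "cmod (deriv g z0) \<le> c * cmod (deriv h z0)"
    and c: "0 < c" "c \<le> 1/4"
  shows "\<exists>e>0. ball z0 e \<subseteq> U \<and> (\<forall>x\<in>ball z0 e. \<forall>y\<in>ball z0 e.
      cmod (g x - g y) \<le> 2 * c * cmod ((h x + cnj (g x)) - (h y + cnj (g y))))"
proof -
  define a where "a = deriv h z0"
  define b where "b = deriv g z0"
  \<comment> \<open>With this \<open>\<eta>\<close>, \<open>g\<close> has Lipschitz constant at most \<open>5/4 * c * cmod a\<close> near \<open>z0\<close> and \<open>f\<close> expands by at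
    least \<open>(1 - 3/2 * c) * cmod a\<close>, which is at least \<open>5/8 * cmod a\<close>; the quotient is \<open>2 * c\<close>.\<close>
  define \<eta> where "\<eta> = c * cmod a / 4"
  have \<eta>: "\<eta> > 0" using c h'0 by (simp add: \<eta>_def a_def)
  have b: "cmod b \<le> c * cmod a" using dil by (simp add: a_def b_def)
  have linear_approx: "\<exists>e>0. ball z0 e \<subseteq> U \<and> (\<forall>x\<in>ball z0 e. \<forall>y\<in>ball z0 e.
      cmod ((k x - k y) - deriv k z0 * (x - y)) \<le> \<eta> * cmod (x - y))"
    if k: "k holomorphic_on U" for k
  proof -
    have "continuous_on U (deriv k)"
      by (intro holomorphic_on_imp_continuous_on holomorphic_deriv k U)
    then have "isCont (deriv k) z0" using U continuous_on_eq_continuous_at by blast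
    then obtain e1 where e1: "e1 > 0" "\<And>x. dist x z0 < e1 \<Longrightarrow> dist (deriv k x) (deriv k z0) < \<eta>"
      using \<eta> unfolding continuous_at_eps_delta by metis
    obtain e2 where e2: "e2 > 0" "ball z0 e2 \<subseteq> U" using U open_contains_ball by blast
    define e where "e = min e1 e2"
    have sub: "ball z0 e \<subseteq> U" using e2(2) by (auto simp: e_def)
    have "cmod ((k x - deriv k z0 * x) - (k y - deriv k z0 * y)) \<le> \<eta> * cmod (x - y)"
      if xy: "x \<in> ball z0 e" "y \<in> ball z0 e" for x y
    proof (rule field_differentiable_bound[OF convex_ball _ _ xy])
      fix w assume w: "w \<in> ball z0 e"
      have "(k has_field_derivative deriv k w) (at w within ball z0 e)"
        using holomorphic_derivI[OF k U(1)] sub w by blast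
      then show "((\<lambda>x. k x - deriv k z0 * x) has_field_derivative deriv k w - deriv k z0) (at w within ball z0 e)"
        by (auto intro!: derivative_eq_intros)
      have "dist w z0 < e1" using w by (simp add: e_def dist_commute)
      then show "cmod (deriv k w - deriv k z0) \<le> \<eta>"
        using e1(2) by (metis dist_norm less_imp_le)
    qed
    moreover have "(k x - deriv k z0 * x) - (k y - deriv k z0 * y) = (k x - k y) - deriv k z0 * (x - y)" for x y
      by (simp add: algebra_simps)
    ultimately show ?thesis using sub e1(1) e2(1) by (intro exI[of _ e]) (auto simp: e_def)
  qed
  obtain e1 where e1: "e1 > 0" "ball z0 e1 \<subseteq> U"
      "\<forall>x\<in>ball z0 e1. \<forall>y\<in>ball z0 e1. cmod ((h x - h y) - a * (x - y)) \<le> \<eta> * cmod (x - y)"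
    using linear_approx[OF h] unfolding a_def by blast
  obtain e2 where e2: "e2 > 0"
      "\<forall>x\<in>ball z0 e2. \<forall>y\<in>ball z0 e2. cmod ((g x - g y) - b * (x - y)) \<le> \<eta> * cmod (x - y)"
    using linear_approx[OF g] unfolding b_def by blast
  have "cmod (g x - g y) \<le> 2 * c * cmod ((h x + cnj (g x)) - (h y + cnj (g y)))"
    if x: "x \<in> ball z0 (min e1 e2)" and y: "y \<in> ball z0 (min e1 e2)" for x y
  proof -
    define \<delta> where "\<delta> = cmod (x - y)"
    define m where "m = cmod a * \<delta>"
    have \<delta>0: "\<delta> \<ge> 0" by (simp add: \<delta>_def)
    have "cmod ((h x - h y) - a * (x - y)) \<le> \<eta> * \<delta>" using e1(3) x y by (simp add: \<delta>_def)
    then have H: "cmod (h x - h y) \<ge> m - c * m / 4"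
      using norm_triangle_ineq2[of "a * (x - y)" "h x - h y"]
      by (simp add: norm_mult norm_minus_commute \<delta>_def \<eta>_def m_def)
    have "cmod ((g x - g y) - b * (x - y)) \<le> \<eta> * \<delta>" using e2(2) x y by (simp add: \<delta>_def)
    then have "cmod (g x - g y) \<le> cmod b * \<delta> + c * m / 4"
      using norm_triangle_ineq2[of "g x - g y" "b * (x - y)"]
      by (simp add: norm_mult \<delta>_def \<eta>_def m_def)
    moreover have "cmod b * \<delta> \<le> c * m"
      using mult_right_mono[OF b \<delta>0] by (simp add: m_def)
    ultimately have G: "cmod (g x - g y) \<le> c * m * (5/4)" by simp
    have "cmod ((h x + cnj (g x)) - (h y + cnj (g y))) \<ge> cmod (h x - h y) - cmod (g x - g y)"
    proof -
      have "cmod (cnj (g x) - cnj (g y)) = cmod (g x - g y)"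
        by (metis complex_cnj_diff complex_mod_cnj)
      then show ?thesis
        using norm_diff_ineq[of "h x - h y" "cnj (g x - g y)"] by (simp add: algebra_simps)
    qed
    then have "m - c * m * (3/2) \<le> cmod ((h x + cnj (g x)) - (h y + cnj (g y)))"
      using H G by simp
    moreover have "m * (5/8) \<le> m * (1 - c * (3/2))"
      using c by (intro mult_left_mono) (auto simp: m_def \<delta>_def)
    ultimately have "m * (5/8) \<le> cmod ((h x + cnj (g x)) - (h y + cnj (g y)))"
      by (simp add: algebra_simps)
    then have "2 * c * (m * (5/8)) \<le> 2 * c * cmod ((h x + cnj (g x)) - (h y + cnj (g y)))"
      using c by (intro mult_left_mono) auto
    then show ?thesis using G by simp
  qed
  then show ?thesis
    using e1(1,2) e2(1) by (intro exI[of _ "min e1 e2"]) auto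
qed

text \<open>
  Along a path of \<open>\<Omega>\<close> of length at most \<open>M * cmod (f x - f y)\<close> the function \<open>g\<close> moves by at most half of \<open>cmod (f x - f y)\<close>, because
  \<open>2 * c * M \<le> 1/2\<close>. Hence \<open>h = f - cnj g\<close> separates points at least half as well as \<open>f\<close> does, and it moves along the
  lifted path by at most \<open>(M + 1/2) * cmod (f x - f y)\<close>.
\<close>
lemma analytic_part_bounded_turning:
  assumes M: "1 \<le> M" and \<Omega>: "linearly_connected M \<Omega>"
    and harm: "harmonic_mapping f h g" and sp: "sense_preserving h g"
    and inj: "inj_on f (ball 0 1)" and im: "f ` ball 0 1 = \<Omega>"
    and c: "0 < c" "c \<le> 1 / (4 * M)" and dil: "\<And>z. z \<in> ball 0 1 \<Longrightarrow> cmod (dilatation h g z) \<le> c"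
  shows "inj_on h (ball 0 1)" "bounded_turning (3 * M) h"
proof -
  have h: "h holomorphic_on ball 0 1" and g: "g holomorphic_on ball 0 1"
    and f: "\<And>z. z \<in> ball 0 1 \<Longrightarrow> f z = h z + cnj (g z)"
    using harm by (auto simp: harmonic_mapping_def)
  have "1 / (4 * M) \<le> 1 / 4" using M by (intro divide_left_mono) auto
  then have c4: "c \<le> 1/4" using c by linarith
  have cM: "2 * c * M \<le> 1/2" using c M by (simp add: field_simps)
  have h'0: "deriv h z \<noteq> 0" and dg: "cmod (deriv g z) \<le> c * cmod (deriv h z)" if z: "z \<in> ball 0 1" for z
  proof -
    have "harmonic_jacobian h g z > 0" using sp z by (simp add: sense_preserving_def)
    then show 0: "deriv h z \<noteq> 0" by (auto simp: harmonic_jacobian_def)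
    show "cmod (deriv g z) \<le> c * cmod (deriv h z)"
      using dil[OF z] 0 by (simp add: dilatation_def norm_divide field_simps)
  qed
  have "continuous_on (ball 0 1) (\<lambda>z. h z + cnj (g z))"
    by (intro continuous_intros holomorphic_on_imp_continuous_on h g)
  then have fcont: "continuous_on (ball 0 1) f"
    using f by (metis (mono_tags, lifting) continuous_on_cong)
  obtain fi where fi: "homeomorphism (ball 0 1) \<Omega> f fi"
    using invariance_of_domain_homeomorphism[OF open_ball fcont _ inj] im by auto
  \<comment> \<open>A Lebesgue number of this cover of a path in the disc makes the local estimate uniform along it.\<close>
  define \<G> where "\<G> = {U. open U \<and> U \<subseteq> ball 0 1 \<and>
      (\<forall>x\<in>U. \<forall>y\<in>U. cmod (g x - g y) \<le> 2 * c * cmod (f x - f y))}"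
  have cover: "\<exists>U\<in>\<G>. z \<in> U" if z: "z \<in> ball 0 1" for z
  proof -
    obtain e where e: "e > 0" "ball z e \<subseteq> ball 0 1" "\<forall>x\<in>ball z e. \<forall>y\<in>ball z e.
      cmod (g x - g y) \<le> 2 * c * cmod ((h x + cnj (g x)) - (h y + cnj (g y)))"
      using coanalytic_part_locally_dominated[OF open_ball z h g h'0[OF z] dg[OF z] c(1) c4] by blast
    have "cmod (g x - g y) \<le> 2 * c * cmod (f x - f y)" if "x \<in> ball z e" "y \<in> ball z e" for x y
    proof -
      have "x \<in> ball 0 1" "y \<in> ball 0 1" using e(2) that by blast+
      then have fx: "f x = h x + cnj (g x)" and fy: "f y = h y + cnj (g y)" using f by blast+
      show ?thesis unfolding fx fy using e(3) that by blast
    qed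
    then have "ball z e \<in> \<G>"
      using e(2) unfolding \<G>_def by blast
    then show ?thesis using e(1) by (meson centre_in_ball)
  qed
  have key: "\<exists>\<beta>. path \<beta> \<and> path_image \<beta> \<subseteq> ball 0 1 \<and> pathstart \<beta> = x \<and> pathfinish \<beta> = y \<and>
       (\<forall>t\<in>{0..1}. cmod (f (\<beta> t) - f x) \<le> M * cmod (f x - f y) \<and>
                  cmod (g (\<beta> t) - g x) \<le> 1/2 * cmod (f x - f y))"
    if x: "x \<in> ball 0 1" and y: "y \<in> ball 0 1" for x y
  proof -
    have "f x \<in> \<Omega>" "f y \<in> \<Omega>" using im x y by auto
    then obtain \<gamma> where \<gamma>: "path \<gamma>" "path_image \<gamma> \<subseteq> \<Omega>" "pathstart \<gamma> = f x" "pathfinish \<gamma> = f y"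
        "path_length \<gamma> \<le> ereal (M * cmod (f x - f y))"
      using \<Omega> unfolding linearly_connected_def by meson
    have \<gamma>in: "\<gamma> t \<in> \<Omega>" if "t \<in> {0..1}" for t
      using \<gamma>(2) that unfolding path_image_def by (meson image_subset_iff)
    define \<beta> where "\<beta> = fi \<circ> \<gamma>"
    have fi': "fi w \<in> ball 0 1" "f (fi w) = w" if "w \<in> \<Omega>" for w
      using fi that unfolding homeomorphism_def by blast+
    have fi2: "fi (f z) = z" if "z \<in> ball 0 1" for z
      using fi that unfolding homeomorphism_def by blast
    have \<beta>path: "path \<beta>" unfolding \<beta>_def
      by (rule path_continuous_image[OF \<gamma>(1)])
         (rule continuous_on_subset[OF homeomorphism_cont2[OF fi] \<gamma>(2)])
    have \<beta>img: "path_image \<beta> \<subseteq> ball 0 1"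
      unfolding \<beta>_def path_image_compose using fi'(1) \<gamma>(2) by blast
    have \<beta>ends: "\<beta> 0 = x" "\<beta> 1 = y"
      using \<gamma>(3,4) fi2 x y by (simp_all add: \<beta>_def pathstart_def pathfinish_def)
    have f\<beta>: "f (\<beta> t) = \<gamma> t" if "t \<in> {0..1}" for t
      using fi'(2) \<gamma>in[OF that] by (simp add: \<beta>_def)
    have "compact (path_image \<beta>)" by (rule compact_path_image[OF \<beta>path])
    moreover have "path_image \<beta> \<subseteq> \<Union>\<G>" using cover \<beta>img by blast
    moreover have "open G" if "G \<in> \<G>" for G using that by (simp add: \<G>_def)
    ultimately obtain e where e: "e > 0" "\<And>z. z \<in> path_image \<beta> \<Longrightarrow> \<exists>G\<in>\<G>. ball z e \<subseteq> G"
      by (metis Heine_Borel_lemma)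
    have "uniformly_continuous_on {0..1} \<beta>"
      using \<beta>path by (intro compact_uniformly_continuous) (auto simp: path_def)
    then obtain d where d: "d > 0" "\<And>s t. s \<in> {0..1} \<Longrightarrow> t \<in> {0..1} \<Longrightarrow> dist t s < d \<Longrightarrow> dist (\<beta> t) (\<beta> s) < e"
      using e(1) unfolding uniformly_continuous_on_def by metis
    have lip: "dist (g (\<beta> s)) (g (\<beta> t)) \<le> (2 * c) * dist (\<gamma> s) (\<gamma> t)"
      if s: "s \<in> {0..1}" and t: "t \<in> {0..1}" and st: "\<bar>s - t\<bar> < d" for s t
    proof -
      have "\<beta> s \<in> path_image \<beta>" using s by (simp add: path_image_def)
      then obtain G where G: "G \<in> \<G>" "ball (\<beta> s) e \<subseteq> G" using e(2) by blast
      have "dist (\<beta> s) (\<beta> t) < e" using d(2)[OF t s] st by (simp add: dist_real_def)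
      then have "\<beta> s \<in> G" "\<beta> t \<in> G" using G(2) e(1) by auto
      then have "cmod (g (\<beta> s) - g (\<beta> t)) \<le> 2 * c * cmod (f (\<beta> s) - f (\<beta> t))"
        using G(1) by (simp add: \<G>_def)
      then show ?thesis using f\<beta> s t by (simp add: dist_norm)
    qed
    have "cmod (f (\<beta> t) - f x) \<le> M * cmod (f x - f y) \<and> cmod (g (\<beta> t) - g x) \<le> 1/2 * cmod (f x - f y)"
      if t: "t \<in> {0..1}" for t
    proof
      have "dist (\<gamma> 0) (\<gamma> t) \<le> 1 * (M * cmod (f x - f y))"
        by (rule dist_along_path_le[OF \<gamma>(5) _ zero_less_one _ t]) auto
      then show "cmod (f (\<beta> t) - f x) \<le> M * cmod (f x - f y)"
        using f\<beta>[OF t] \<gamma>(3) by (simp add: dist_norm norm_minus_commute pathstart_def)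
      have "dist (g (\<beta> 0)) (g (\<beta> t)) \<le> (2 * c) * (M * cmod (f x - f y))"
        by (rule dist_along_path_le[OF \<gamma>(5) _ d(1) lip t]) (use c in auto)
      also have "\<dots> = (2 * c * M) * cmod (f x - f y)" by (simp only: mult.assoc)
      also have "\<dots> \<le> 1/2 * cmod (f x - f y)" by (rule mult_right_mono[OF cM]) simp
      finally show "cmod (g (\<beta> t) - g x) \<le> 1/2 * cmod (f x - f y)"
        unfolding \<beta>ends by (simp add: dist_norm norm_minus_commute)
    qed
    then show ?thesis
      using \<beta>path \<beta>img \<beta>ends by (intro exI[of _ \<beta>]) (auto simp: pathstart_def pathfinish_def)
  qed
  have hfg: "h z = f z - cnj (g z)" if "z \<in> ball 0 1" for z using f[OF that] by simp
  have cn: "cmod (cnj a - cnj b) = cmod (a - b)" for a b by (metis complex_cnj_diff complex_mod_cnj)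
  have lower: "cmod (f x - f y) \<le> 2 * cmod (h x - h y)" if x: "x \<in> ball 0 1" and y: "y \<in> ball 0 1" for x y
  proof -
    obtain \<beta> where \<beta>: "pathfinish \<beta> = y" "\<forall>t\<in>{0..1}. cmod (f (\<beta> t) - f x) \<le> M * cmod (f x - f y) \<and>
                  cmod (g (\<beta> t) - g x) \<le> 1/2 * cmod (f x - f y)"
      using key[OF x y] by blast
    from \<beta>(2)[rule_format, of 1] \<beta>(1) have gg: "cmod (g y - g x) \<le> 1/2 * cmod (f x - f y)"
      by (simp add: pathfinish_def)
    have "h x - h y = (f x - f y) - (cnj (g x) - cnj (g y))" using hfg x y by simp
    then show ?thesis
      using norm_triangle_ineq2[of "f x - f y" "cnj (g x) - cnj (g y)"] gg
      by (simp add: cn norm_minus_commute)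
  qed
  show "inj_on h (ball 0 1)"
  proof (rule inj_onI)
    fix x y assume xy: "x \<in> ball 0 1" "y \<in> ball 0 1" "h x = h y"
    then have "f x = f y" using lower[OF xy(1,2)] by simp
    then show "x = y" using inj_onD[OF inj] xy by blast
  qed
  show "bounded_turning (3 * M) h"
    unfolding bounded_turning_def
  proof (intro ballI)
    fix x y :: complex assume x: "x \<in> ball 0 1" and y: "y \<in> ball 0 1"
    obtain \<beta> where \<beta>: "path \<beta>" "path_image \<beta> \<subseteq> ball 0 1" "pathstart \<beta> = x" "pathfinish \<beta> = y"
       "\<forall>t\<in>{0..1}. cmod (f (\<beta> t) - f x) \<le> M * cmod (f x - f y) \<and>
                  cmod (g (\<beta> t) - g x) \<le> 1/2 * cmod (f x - f y)"
      using key[OF x y] by blast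
    have "cmod (h (\<beta> t) - h x) \<le> 3 * M * cmod (h x - h y)" if t: "t \<in> {0..1}" for t
    proof -
      have "\<beta> t \<in> ball 0 1"
        using \<beta>(2) t unfolding path_image_def by (meson image_subset_iff)
      then have "h (\<beta> t) - h x = (f (\<beta> t) - f x) - (cnj (g (\<beta> t)) - cnj (g x))" using hfg x by simp
      then have "cmod (h (\<beta> t) - h x) \<le> cmod (f (\<beta> t) - f x) + cmod (g (\<beta> t) - g x)"
        by (metis norm_triangle_ineq4 cn)
      also have "\<dots> \<le> M * cmod (f x - f y) + 1/2 * cmod (f x - f y)"
        using \<beta>(5) t by (intro add_mono) auto
      also have "\<dots> = (M + 1/2) * cmod (f x - f y)" by (simp add: algebra_simps)
      also have "\<dots> \<le> (3/2 * M) * (2 * cmod (h x - h y))"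
        using M lower[OF x y] by (intro mult_mono) auto
      finally show ?thesis by simp
    qed
    then show "\<exists>\<beta>. path \<beta> \<and> path_image \<beta> \<subseteq> ball 0 1 \<and> pathstart \<beta> = x \<and> pathfinish \<beta> = y \<and>
        (\<forall>t\<in>{0..1}. cmod (h (\<beta> t) - h x) \<le> 3 * M * cmod (h x - h y))"
      using \<beta>(1-4) by blast
  qed
qed

text \<open>
  The two sides differ by the term of \<open>P_op\<close> that contains the derivative of the dilatation. As the dilatation is
  bounded by \<open>c\<close>, Cauchy's estimate on a circle of radius \<open>(1 - cmod z) / 2\<close> makes that term of size \<open>c\<^sup>2\<close>
  after multiplication by \<open>(1 - (cmod z)\<^sup>2) / 2\<close>.
\<close>
lemma A_op_close_to_analytic_part:
  assumes h: "h holomorphic_on ball 0 1" and g: "g holomorphic_on ball 0 1"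
    and sp: "sense_preserving h g" and c: "0 < c" "c \<le> 1/4"
    and dil: "\<And>z. z \<in> ball 0 1 \<Longrightarrow> cmod (dilatation h g z) \<le> c" and z: "z \<in> ball 0 1"
  shows "cmod (A_op h g z) \<le>
    cmod (of_real ((1 - (cmod z)\<^sup>2) / 2) * (deriv (deriv h) z / deriv h z) - cnj z) + c"
proof -
  define \<omega> where "\<omega> = dilatation h g"
  define a where "a = (1 - (cmod z)\<^sup>2) / 2"
  define r where "r = (1 - cmod z) / 2"
  define cor where "cor = cnj (\<omega> z) * deriv \<omega> z / complex_of_real (1 - (cmod (\<omega> z))\<^sup>2)"
  have z1: "cmod z < 1" using z by simp
  have r: "r > 0" using z1 by (simp add: r_def)
  have a: "a = (1 + cmod z) * r" by (simp add: a_def r_def algebra_simps power2_eq_square)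
  have h'0: "deriv h z \<noteq> 0" if z: "z \<in> ball 0 1" for z
    using sp z unfolding sense_preserving_def harmonic_jacobian_def by (auto dest: bspec)
  have \<omega>: "\<omega> holomorphic_on ball 0 1"
    unfolding \<omega>_def dilatation_def
    by (intro holomorphic_on_divide holomorphic_deriv h g h'0 open_ball)
  have sub: "cball z r \<subseteq> ball 0 1"
  proof
    fix w assume "w \<in> cball z r"
    then have "cmod w \<le> cmod z + r" using norm_triangle_sub[of w z] by (simp add: dist_norm norm_minus_commute)
    moreover have "2 * r = 1 - cmod z" by (simp add: r_def)
    ultimately have "cmod w < 1" using r by linarith
    then show "w \<in> ball 0 1" by simp
  qed
  have "cmod ((deriv ^^ 1) \<omega> z) \<le> fact 1 * c / r ^ 1"
  proof (rule Cauchy_inequality)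
    show "\<omega> holomorphic_on ball z r"
      by (rule holomorphic_on_subset[OF \<omega>]) (use sub ball_subset_cball in blast)
    show "continuous_on (cball z r) \<omega>"
      by (rule continuous_on_subset[OF holomorphic_on_imp_continuous_on[OF \<omega>] sub])
    show "cmod (\<omega> x) \<le> c" if "cmod (z - x) = r" for x
      unfolding \<omega>_def using sub that by (intro dil) (auto simp: dist_norm subset_iff)
  qed (rule r)
  then have d\<omega>: "cmod (deriv \<omega> z) \<le> c / r" by simp
  have wc: "cmod (\<omega> z) \<le> c" unfolding \<omega>_def by (rule dil[OF z])
  have "(cmod (\<omega> z))\<^sup>2 \<le> (1/4)\<^sup>2" using wc c by (intro power_mono) auto
  then have den: "1 - (cmod (\<omega> z))\<^sup>2 \<ge> 1/2" by (simp add: power_divide)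
  have "cmod cor = cmod (\<omega> z) * cmod (deriv \<omega> z) / (1 - (cmod (\<omega> z))\<^sup>2)"
    using den by (simp add: cor_def norm_divide norm_mult del: of_real_diff)
  also have "\<dots> \<le> (c * (c / r)) / (1/2)"
    using wc d\<omega> c den r by (intro frac_le mult_mono) auto
  finally have cor: "cmod cor \<le> (c * (c / r)) / (1/2)" .
  have a0: "a \<ge> 0" using r by (simp add: a)
  then have "cmod (of_real a * cor) = a * cmod cor"
    by (simp only: norm_mult norm_of_real abs_of_nonneg)
  also have "\<dots> \<le> a * ((c * (c / r)) / (1/2))"
    by (rule mult_left_mono[OF cor a0])
  also have "\<dots> = 2 * (1 + cmod z) * c * c" using r by (simp add: a)
  also have "\<dots> \<le> 4 * c * c" using z1 c by (intro mult_right_mono) auto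
  also have "\<dots> \<le> c" using c by simp
  finally have bound: "cmod (of_real a * cor) \<le> c" .
  have "A_op h g z = (of_real a * (deriv (deriv h) z / deriv h z) - cnj z) - of_real a * cor"
    unfolding A_op_def P_op_eq[OF h g sp z] a_def cor_def \<omega>_def by (simp add: right_diff_distrib)
  then have "cmod (A_op h g z) \<le> cmod (of_real a * (deriv (deriv h) z / deriv h z) - cnj z) + cmod (of_real a * cor)"
    by (metis norm_triangle_ineq4)
  then show ?thesis using bound unfolding a_def by linarith
qed

theorem theorem3:
  fixes M :: real and \<Omega> :: "complex set"
  assumes "1 \<le> M"
    and "open \<Omega>" and "connected \<Omega>" and "\<Omega> \<noteq> {}"
    and "linearly_connected M \<Omega>"
  shows "\<exists>c::real. 0 < c \<and> c < 1 \<and>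
    (\<forall>f h g. harmonic_mapping f h g \<and> sense_preserving h g \<and>
       inj_on f (ball 0 1) \<and> f ` ball 0 1 = \<Omega> \<and>
       (\<forall>z\<in>ball 0 1. cmod (dilatation h g z) \<le> c)
       \<longrightarrow> upper_order h g < 2)"
proof -
  \<comment> \<open>The analytic part has bounded turning with constant \<open>3 * M\<close>, so its order is at most
    \<open>2 * sqrt (1 - r\<^sup>2) \<le> 2 - r\<^sup>2 = 2 - 2 * c\<close>; replacing it by \<open>f\<close> costs at most \<open>c\<close>.\<close>
  define r where "r = 1 / (1620 * (3 * M))"
  define c where "c = r\<^sup>2 / 2"
  have r: "0 < r" "r \<le> 1 / M" "r \<le> 1 / 4"
    using assms(1) by (auto simp: r_def field_simps)
  have "r\<^sup>2 \<le> 1 / M * (1/4)" unfolding power2_eq_square using r assms(1) by (intro mult_mono) auto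
  then have c: "0 < c" "c \<le> 1 / (4 * M)" using r by (auto simp: c_def)
  have "1 / (4 * M) \<le> 1 / 4" using assms(1) by (intro divide_left_mono) auto
  then have c4: "c \<le> 1/4" using c by linarith
  have "upper_order h g < 2"
    if harm: "harmonic_mapping f h g" and sp: "sense_preserving h g" and inj: "inj_on f (ball 0 1)"
      and im: "f ` ball 0 1 = \<Omega>" and dil: "\<forall>z\<in>ball 0 1. cmod (dilatation h g z) \<le> c" for f h g
  proof -
    have h: "h holomorphic_on ball 0 1" and g: "g holomorphic_on ball 0 1"
      using harm by (auto simp: harmonic_mapping_def)
    note bt = analytic_part_bounded_turning[OF assms(1,5) harm sp inj im c dil[rule_format]]
    have "cmod (A_op h g z) \<le> 2 - c" if z: "z \<in> ball 0 1" for z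
    proof -
      define B where "B = cmod (of_real ((1 - (cmod z)\<^sup>2) / 2) * (deriv (deriv h) z / deriv h z) - cnj z)"
      have "(B / 2)\<^sup>2 + r\<^sup>2 \<le> 1"
        using pre_Schwarzian_bounded_turning[OF h bt _ z] assms(1)
        by (simp add: B_def r_def norm_divide)
      moreover have "1 - r\<^sup>2 \<le> (1 - c)\<^sup>2"
        using r(1) by (simp add: c_def power2_eq_square algebra_simps)
      ultimately have "(B / 2)\<^sup>2 \<le> (1 - c)\<^sup>2" by linarith
      then have "B / 2 \<le> 1 - c" by (rule power2_le_imp_le) (use c4 in simp)
      moreover have "cmod (A_op h g z) \<le> B + c"
        unfolding B_def by (rule A_op_close_to_analytic_part[OF h g sp c(1) c4 dil[rule_format] z])
      ultimately show ?thesis by linarith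
    qed
    then have "upper_order h g \<le> ereal (2 - c)"
      unfolding upper_order_def by (intro SUP_least) simp
    also have "\<dots> < 2" using c(1) by simp
    finally show ?thesis .
  qed
  then show ?thesis using c(1) c4 by (intro exI[of _ c]) auto
qed

end
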